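(* Let $m=2$, let $u,v$ be the columns of $\mathcal{B}$, so that $I=\langle\partial^{u_+}-\partial^{u_-},\partial^{v_+}-\partial^{v_-}\rangle$, and let $\alpha\in\mathbb{N}^n$ satisfy: $\alpha_i>0\Rightarrow u_i>0$. Then for generic $c\in\mathbb{C}^n$, every holomorphic solution of the left $D_n$-ideal $D_nI+D_n\langle\partial^\alpha\rangle+\langle A\theta-Ac\rangle$ is a Puiseux polynomial.
   Context: $\mathcal{B}\in\mathbb{Z}^{n\times2}$ ($n>2$) of rank 2 with rows summing to zero; $A=(a_{kj})\in\mathbb{Z}^{(n-2)\times n}$ of rank $n-2$, first row all ones, $A\mathcal{B}=0$. For $w\in\mathbb{Z}^n$, $w=w_+-w_-$ with $w_\pm\ge0$ of disjoint supports. $\langle A\theta-Ac\rangle$ is the left ideal generated by $\sum_ja_{kj}x_j\partial_j-(Ac)_k$. A Puiseux polynomial is a finite linear combination of monomials $x^p$, $p\in\mathbb{C}^n$. Generic: outside an exceptional measure-zero set. *)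

theory Defs
  imports "HOL-Analysis.Analysis"
begin

(* Rank of an integer matrix with rows indexed by R and columns indexed by the
   finite type 'c: the dimension of the row space (over the reals; for integer
   matrices this equals the rank over Q or C). *)
definition int_mat_rank :: "('r \<Rightarrow> 'c::finite \<Rightarrow> int) \<Rightarrow> 'r set \<Rightarrow> nat" where
  "int_mat_rank M R = dim ((\<lambda>r. (\<chi> c. real_of_int (M r c)) :: real^'c) ` R)"

definition pospart :: "('n \<Rightarrow> int) \<Rightarrow> 'n \<Rightarrow> nat" where
  "pospart w i = nat (w i)"
definition negpart :: "('n \<Rightarrow> int) \<Rightarrow> 'n \<Rightarrow> nat" where
  "negpart w i = nat (- w i)"

definition holo_on :: "(complex^'n \<Rightarrow> complex) \<Rightarrow> (complex^'n) set \<Rightarrow> bool" where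
  "holo_on f U \<longleftrightarrow> (\<forall>x\<in>U. \<exists>L. (f has_derivative L) (at x) \<and>
                          (\<forall>(c::complex) h. L (c *s h) = c * L h))"

definition cpartial :: "'n \<Rightarrow> (complex^'n \<Rightarrow> complex) \<Rightarrow> complex^'n \<Rightarrow> complex" where
  "cpartial j f x = deriv (\<lambda>t. f (\<chi> i. if i = j then t else x $ i)) (x $ j)"

(* the monomial differential operator \<partial>^\<beta>, applied variable by variable
   (the order is irrelevant for holomorphic functions) *)
definition dmono :: "('n::finite \<Rightarrow> nat) \<Rightarrow> (complex^'n \<Rightarrow> complex) \<Rightarrow> complex^'n \<Rightarrow> complex" where
  "dmono \<beta> f = foldr (\<lambda>j g. (cpartial j ^^ \<beta> j) g)
                 (SOME xs. distinct xs \<and> set xs = (UNIV :: 'n set)) f"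

(* f is a holomorphic solution on U of the left D_n-ideal
   D_n<\<partial>^{u+}-\<partial>^{u-}, \<partial>^{v+}-\<partial>^{v-}> + D_n<\<partial>^\<alpha>> + <A\<theta> - Ac>,
   i.e. f is annihilated by the generators (A has rows 0..<m) *)
definition is_solution ::
  "('n::finite \<Rightarrow> int) \<Rightarrow> ('n \<Rightarrow> int) \<Rightarrow> ('n \<Rightarrow> nat) \<Rightarrow> (nat \<Rightarrow> 'n \<Rightarrow> int) \<Rightarrow> nat
   \<Rightarrow> complex^'n \<Rightarrow> (complex^'n \<Rightarrow> complex) \<Rightarrow> (complex^'n) set \<Rightarrow> bool" where
  "is_solution u v \<alpha> A m c f U \<longleftrightarrow>
     holo_on f U \<and>
     (\<forall>x\<in>U. dmono (pospart u) f x - dmono (negpart u) f x = 0) \<and>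
     (\<forall>x\<in>U. dmono (pospart v) f x - dmono (negpart v) f x = 0) \<and>
     (\<forall>x\<in>U. dmono \<alpha> f x = 0) \<and>
     (\<forall>k<m. \<forall>x\<in>U. (\<Sum>j\<in>UNIV. of_int (A k j) * x $ j * cpartial j f x)
                    - (\<Sum>j\<in>UNIV. of_int (A k j) * c $ j) * f x = 0)"

(* Puiseux polynomial on U: a finite linear combination of monomials
   x^p = exp(\<Sum>_j p_j log x_j), p \<in> C^n, for some continuous branches of the
   logarithms of the coordinates on U *)
definition puiseux_on :: "(complex^'n::finite \<Rightarrow> complex) \<Rightarrow> (complex^'n) set \<Rightarrow> bool" where
  "puiseux_on f U \<longleftrightarrow>
     (\<exists>P :: (complex^'n) set. \<exists>coef :: complex^'n \<Rightarrow> complex. \<exists>lg :: 'n \<Rightarrow> complex \<Rightarrow> complex.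
        finite P \<and>
        (\<forall>j. continuous_on ((\<lambda>x. x $ j) ` U) (lg j) \<and> (\<forall>x\<in>U. exp (lg j (x $ j)) = x $ j)) \<and>
        (\<forall>x\<in>U. f x = (\<Sum>p\<in>P. coef p * exp (\<Sum>j\<in>UNIV. p $ j * lg j (x $ j)))))"

end

theory Submission
  imports Defs "HOL-Complex_Analysis.Cauchy_Integral_Formula" "HOL-Library.Function_Algebras"
begin

text \<open>
  Write \<open>\<theta>\<^sub>j = x\<^sub>j \<partial>\<^sub>j\<close>. A solution \<open>f\<close> is killed by \<open>\<partial>\<^sup>\<alpha>\<close>, hence by \<open>\<partial>\<close> to the power \<open>N u\<^sub>+\<close> for large \<open>N\<close>, and
  so, by the first binomial operator, by \<open>\<partial>\<close> to the power \<open>N u\<^sub>-\<close>. Therefore \<open>f\<close> is killed by a product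
  of factors \<open>\<theta>\<^sub>i - k\<close> with \<open>u\<^sub>i > 0\<close>, and by a product of factors \<open>\<theta>\<^sub>j - k\<close> with \<open>u\<^sub>j < 0\<close>. The Euler operators
  let the \<open>\<theta>\<^sub>l - c\<^sub>l\<close> act through two operators, as linear forms given by the rows of the matrix; so
  these factors are lines in a plane, which for generic \<open>c\<close> are in general position. Hence \<open>f\<close> is a
  sum of joint eigenvectors of the \<open>\<theta>\<^sub>l\<close>, one for each intersection point of a line of the first kind
  with a line of the second kind, and a joint eigenvector on a ball is a multiple of a monomial.
\<close>

section \<open>Partial derivatives of holomorphic functions\<close>

lemma norm_axis: "norm (axis j (z :: complex) :: complex^'n::finite) = norm z"
  by (simp add: norm_vec_def axis_def L2_set_def if_distrib[of "\<lambda>a. norm a"] if_distrib[of "\<lambda>a. a\<^sup>2"]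
      cong: if_cong)

lemma bounded_linear_axis: "bounded_linear (\<lambda>t. axis j t :: complex^'n::finite)"
  by (rule bounded_linear_intro[of _ 1]) (simp_all add: norm_axis, simp_all add: vec_eq_iff axis_def)

lemma axis_0: "axis j 0 = 0"
  by (simp add: vec_eq_iff axis_def)

text \<open>A complex linear \<open>L\<close> is determined by its values on the vectors
  \<open>axis j 1\<close>, and the chain rule along a coordinate line identifies these values with
  the one-variable derivatives in \<open>cpartial\<close>. Writing the line as
  \<open>x + axis j (t - x $ j)\<close> makes its dependence on \<open>t\<close> visibly
  affine.\<close>

lemma holo_onD:
  fixes f :: "complex^'n::finite \<Rightarrow> complex"
  assumes "holo_on f U" "x \<in> U"
  shows holo_on_has_derivative: "(f has_derivative (\<lambda>h. \<Sum>j\<in>UNIV. h $ j * cpartial j f x)) (at x)"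
    and holo_on_slice: "((\<lambda>t. f (x + axis j (t - x $ j))) has_field_derivative cpartial j f x) (at (x $ j))"
proof -
  obtain L where L: "(f has_derivative L) (at x)" and lin: "\<And>c h. L (c *s h) = c * L h"
    using assms unfolding holo_on_def by blast
  interpret L: bounded_linear L using L by (rule has_derivative_bounded_linear)
  have slice: "((\<lambda>t. f (x + axis j (t - x $ j))) has_field_derivative L (axis j 1)) (at (x $ j))" for j
  proof -
    have "((\<lambda>t. x + axis j (t - x $ j)) has_derivative (\<lambda>h. axis j h)) (at (x $ j))"
      by (auto intro!: derivative_eq_intros bounded_linear.has_derivative[OF bounded_linear_axis])
    moreover have "(f has_derivative L) (at (x + axis j (x $ j - x $ j)))"
      using L by (simp add: axis_0)
    ultimately have "((\<lambda>t. f (x + axis j (t - x $ j))) has_derivative (\<lambda>h. L (axis j h))) (at (x $ j))"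
      using diff_chain_at by (fastforce simp: o_def)
    moreover have "(\<lambda>h. L (axis j h)) = (*) (L (axis j 1))"
    proof
      fix h :: complex
      have "axis j h = h *s axis j 1" by (simp add: vec_eq_iff axis_def)
      then have "L (axis j h) = h * L (axis j 1)" by (simp only: lin)
      then show "L (axis j h) = L (axis j 1) * h" by (simp only: mult.commute)
    qed
    ultimately show ?thesis by (simp add: has_field_derivative_def)
  qed
  have part: "L (axis j 1) = cpartial j f x" for j
  proof -
    have "(\<chi> i. if i = j then t else x $ i) = x + axis j (t - x $ j)" for t
      by (auto simp: vec_eq_iff axis_def)
    then show ?thesis using DERIV_imp_deriv[OF slice, of j] unfolding cpartial_def by simp
  qed
  show "((\<lambda>t. f (x + axis j (t - x $ j))) has_field_derivative cpartial j f x) (at (x $ j))"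
    using slice part by simp
  have "L h = (\<Sum>j\<in>UNIV. h $ j * cpartial j f x)" for h
  proof -
    have "L h = L (\<Sum>j\<in>UNIV. h $ j *s axis j 1)" by (simp add: basis_expansion)
    also have "\<dots> = (\<Sum>j\<in>UNIV. h $ j * cpartial j f x)" by (simp add: L.sum lin part)
    finally show ?thesis .
  qed
  then have "L = (\<lambda>h. \<Sum>j\<in>UNIV. h $ j * cpartial j f x)" by (rule ext)
  then show "(f has_derivative (\<lambda>h. \<Sum>j\<in>UNIV. h $ j * cpartial j f x)) (at x)"
    using L by simp
qed

lemma holo_onI:
  fixes f :: "complex^'n::finite \<Rightarrow> complex"
  assumes "\<And>x. x \<in> U \<Longrightarrow> (f has_derivative (\<lambda>h. \<Sum>j\<in>UNIV. h $ j * d j x)) (at x)"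
  shows "holo_on f U" 
  unfolding holo_on_def
proof (intro ballI exI conjI allI)
  fix x assume "x \<in> U"
  then show "(f has_derivative (\<lambda>h. \<Sum>j\<in>UNIV. h $ j * d j x)) (at x)" by (rule assms)
qed (simp add: sum_distrib_left mult.assoc)

lemma cpartial_eqI:
  fixes f :: "complex^'n::finite \<Rightarrow> complex"
  assumes "(f has_derivative (\<lambda>h. \<Sum>j\<in>UNIV. h $ j * d j)) (at x)"
  shows "cpartial j f x = d j"
proof -
  \<comment> \<open>\<open>holo_on\<close> asks for derivatives \<open>at x\<close> in the full
    space, so a single point is a legitimate domain. Uniqueness of the derivative, tested on
    \<open>axis j 1\<close>, then gives the claim.\<close>
  have "holo_on f {x}" using assms by (intro holo_onI[of _ _ "\<lambda>j _. d j"]) simp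
  then have "(f has_derivative (\<lambda>h. \<Sum>j\<in>UNIV. h $ j * cpartial j f x)) (at x)"
    by (rule holo_on_has_derivative) simp
  from has_derivative_unique[OF this assms]
  have "(\<Sum>i\<in>UNIV. axis j 1 $ i * cpartial i f x) = (\<Sum>i\<in>UNIV. axis j 1 $ i * d i)"
    by meson
  moreover have "(\<Sum>i\<in>UNIV. axis j 1 $ i * g i) = g j" for g :: "'n \<Rightarrow> complex"
    by (simp add: axis_def if_distrib[of "\<lambda>a. a * _"] cong: if_cong)
  ultimately show ?thesis by simp
qed

section \<open>Cauchy's formula and the regularity of partial derivatives\<close>

lemma cpartial_cauchy:
  fixes f :: "complex^'n::finite \<Rightarrow> complex"
  assumes "holo_on f U" "cball y \<rho> \<subseteq> U" "\<rho> > 0"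
  defines "e \<equiv> \<lambda>t::real. \<rho> * exp (2 * of_real pi * \<i> * of_real t)"
  shows "cpartial j f y = integral (cbox 0 1) (\<lambda>t. f (y + axis j (e t)) / e t)"
proof -
  define g where "g = (\<lambda>z. f (y + axis j (z - y $ j)))"
  have in_U: "y + axis j (z - y $ j) \<in> U" if "z \<in> cball (y $ j) \<rho>" for z
  proof -
    have "y + axis j (z - y $ j) \<in> cball y \<rho>"
      using that by (simp add: dist_norm norm_axis norm_minus_commute)
    then show ?thesis using assms(2) by blast
  qed
  have der: "(g has_field_derivative cpartial j f (y + axis j (z - y $ j))) (at z)"
    if "z \<in> cball (y $ j) \<rho>" for z
  proof -
    have "(\<lambda>t. f (y + axis j (z - y $ j) + axis j (t - (y + axis j (z - y $ j)) $ j))) = g"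
      unfolding g_def by (intro ext arg_cong[of _ _ f]) (auto simp: vec_eq_iff axis_def)
    moreover have "(y + axis j (z - y $ j)) $ j = z" by (simp add: axis_def)
    ultimately show ?thesis
      using holo_on_slice[OF assms(1) in_U[OF that], of j] by simp
  qed
  have "contour_integral (circlepath (y $ j) \<rho>) (\<lambda>u. g u / (u - y $ j)^2) = (2 * pi * \<i>) * deriv g (y $ j)"
  proof (rule Cauchy_contour_integral_circlepath_2)
    show "continuous_on (cball (y $ j) \<rho>) g"
      using der by (meson DERIV_isCont continuous_at_imp_continuous_on)
    show "g holomorphic_on ball (y $ j) \<rho>"
      unfolding holomorphic_on_def field_differentiable_def
    proof (intro ballI exI)
      fix z assume "z \<in> ball (y $ j) \<rho>"
      then have "z \<in> cball (y $ j) \<rho>" by simp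
      from der[OF this]
      show "(g has_field_derivative cpartial j f (y + axis j (z - y $ j))) (at z within ball (y $ j) \<rho>)"
        by (rule has_field_derivative_at_within)
    qed
  qed (use assms in auto)
  moreover have "deriv g (y $ j) = cpartial j f y"
    using DERIV_imp_deriv[OF der[of "y $ j"]] assms(3) by (simp add: axis_0)
  \<comment> \<open>On the circle \<open>u - y $ j = e t\<close> and
    \<open>du = 2 * pi * \<i> * e t dt\<close>, which cancels one of the two powers in the
    denominator.\<close>
  moreover have "contour_integral (circlepath (y $ j) \<rho>) (\<lambda>u. g u / (u - y $ j)^2)
     = integral (cbox 0 1) (\<lambda>t. 2 * pi * \<i> * (f (y + axis j (e t)) / e t))"
    unfolding contour_integral_integral cbox_interval
  proof (rule integral_cong)
    fix t :: real
    have "e t \<noteq> 0" using assms by (simp add: e_def)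
    then show "g (circlepath (y $ j) \<rho> t) / (circlepath (y $ j) \<rho> t - y $ j)\<^sup>2 * vector_derivative (circlepath (y $ j) \<rho>) (at t)
       = 2 * pi * \<i> * (f (y + axis j (e t)) / e t)"
      unfolding vector_derivative_circlepath
      by (simp add: circlepath e_def g_def power2_eq_square field_simps)
  qed
  ultimately have "2 * pi * \<i> * cpartial j f y
      = 2 * pi * \<i> * integral (cbox 0 1) (\<lambda>t. f (y + axis j (e t)) / e t)"
    by (simp only: integral_mult_right)
  then show ?thesis by (simp only: mult_cancel_left) simp
qed

lemma holo_on_continuous: "holo_on f U \<Longrightarrow> continuous_on U f"
  by (meson continuous_at_imp_continuous_on has_derivative_continuous holo_on_has_derivative)

text \<open>The margin of a second \<open>\<rho>\<close> lets one fixed radius serve the Cauchy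
  circles around all points of a small ball, so that Cauchy's integral can be differentiated with
  respect to the centre.\<close>

lemma cball_subset_shift:
  assumes "cball x (2 * \<rho>) \<subseteq> U" "y \<in> ball x \<rho>"
  shows "cball y \<rho> \<subseteq> U"
proof
  fix z assume "z \<in> cball y \<rho>"
  then have "dist x z \<le> 2 * \<rho>"
    using assms(2) dist_triangle[of x z y] by auto
  then show "z \<in> U" using assms(1) by auto
qed

context
  fixes U :: "(complex^'n::finite) set" and x0 :: "complex^'n" and \<rho> :: real and e :: "real \<Rightarrow> complex"
  assumes \<rho>: "\<rho> > 0" and sub: "cball x0 (2 * \<rho>) \<subseteq> U"
  defines "e \<equiv> \<lambda>t::real. \<rho> * exp (2 * of_real pi * \<i> * of_real t)"
begin

lemma circle_facts:
  shows "e t \<noteq> 0" "norm (e t) = \<rho>" "continuous_on S e"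
    "y \<in> ball x0 \<rho> \<Longrightarrow> y + axis j (e t) \<in> U"
proof -
  show *: "e t \<noteq> 0" "norm (e t) = \<rho>" for t using \<rho> by (auto simp: e_def norm_mult)
  show "continuous_on S e" unfolding e_def by (intro continuous_intros)
  assume "y \<in> ball x0 \<rho>"
  then show "y + axis j (e t) \<in> U"
    using cball_subset_shift[OF sub] * by (force simp: dist_norm norm_axis)
qed

lemma continuous_on_circle:
  assumes "continuous_on U g"
  shows "continuous_on (ball x0 \<rho> \<times> cbox 0 1) (\<lambda>(y, t). g (y + axis j (e t)) / e t)"
proof -
  have "continuous_on (ball x0 \<rho> \<times> cbox 0 1) (\<lambda>p. g (fst p + axis j (e (snd p))) / e (snd p))"
    by (intro continuous_intros continuous_on_compose2[OF assms]
          bounded_linear.continuous_on[OF bounded_linear_axis] continuous_on_compose2[OF circle_facts(3)[of UNIV]])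
       (auto simp: circle_facts)
  then show ?thesis by (simp add: case_prod_unfold)
qed

lemma cpartial_circle:
  assumes "holo_on f U" "y \<in> ball x0 \<rho>"
  shows "cpartial j f y = integral (cbox 0 1) (\<lambda>t. f (y + axis j (e t)) / e t)"
  unfolding e_def by (rule cpartial_cauchy[OF assms(1) cball_subset_shift[OF sub assms(2)] \<rho>])

lemma cpartial_continuous_ball:
  assumes "holo_on f U" shows "continuous_on (ball x0 \<rho>) (cpartial j f)"
  using integral_continuous_on_param[OF continuous_on_circle[OF holo_on_continuous[OF assms]], of j]
  by (rule continuous_on_eq) (simp add: cpartial_circle[OF assms])

text \<open>Leibniz's rule applied to Cauchy's integral; continuity of the first partials makes the
  differentiated integrand jointly continuous in \<open>y\<close> and \<open>t\<close>. Each
  coefficient is again a Cauchy integral in direction \<open>j\<close>, now of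
  \<open>cpartial k f\<close>, and this form yields the symmetry of second partials.\<close>

lemma cpartial_has_derivative:
  assumes "holo_on f U" and cont: "\<And>k. continuous_on U (cpartial k f)"
  shows "(cpartial j f has_derivative
            (\<lambda>h. \<Sum>k\<in>UNIV. h $ k * integral (cbox 0 1) (\<lambda>t. cpartial k f (x0 + axis j (e t)) / e t))) (at x0)"
proof -
  define D where "D = (\<lambda>y t. Blinfun (\<lambda>h. (\<Sum>k\<in>UNIV. h $ k * cpartial k f (y + axis j (e t))) / e t))"
  have hd: "((\<lambda>y. f (y + axis j (e t)) / e t) has_derivative
       (\<lambda>h. (\<Sum>k\<in>UNIV. h $ k * cpartial k f (y + axis j (e t))) / e t)) (at y)"
    if "y \<in> ball x0 \<rho>" for y t
  proof -
    have "((\<lambda>y. f (y + axis j (e t))) has_derivative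
       (\<lambda>h. (\<Sum>k\<in>UNIV. h $ k * cpartial k f (y + axis j (e t))))) (at y)"
      by (rule has_derivative_compose[where f = "\<lambda>y. y + axis j (e t)" and f' = "\<lambda>h. h"])
         (auto intro!: derivative_eq_intros holo_on_has_derivative[OF assms(1)] circle_facts that)
    then show ?thesis by (auto intro!: derivative_eq_intros simp: circle_facts)
  qed
  have D: "blinfun_apply (D y t) = (\<lambda>h. (\<Sum>k\<in>UNIV. h $ k * cpartial k f (y + axis j (e t))) / e t)"
    if "y \<in> ball x0 \<rho>" for y t
    unfolding D_def by (intro bounded_linear_Blinfun_apply has_derivative_bounded_linear[OF hd[OF that]])
  have x0: "x0 \<in> ball x0 \<rho>" using \<rho> by simp
  have contD: "continuous_on (ball x0 \<rho> \<times> cbox 0 1) (\<lambda>(y, t). D y t)"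
  proof (rule continuous_on_blinfun_componentwise)
    fix i :: "complex^'n"
    have "continuous_on (ball x0 \<rho> \<times> cbox 0 1)
       (\<lambda>p. \<Sum>k\<in>UNIV. i $ k * (case p of (y, t) \<Rightarrow> cpartial k f (y + axis j (e t)) / e t))"
      by (intro continuous_intros continuous_on_circle cont)
    then show "continuous_on (ball x0 \<rho> \<times> cbox 0 1) (\<lambda>p. blinfun_apply (case p of (y, t) \<Rightarrow> D y t) i)"
      by (rule continuous_on_eq) (auto simp: D sum_divide_distrib)
  qed
  have int: "(\<lambda>t. g (y + axis j (e t)) / e t) integrable_on cbox 0 1"
    if "continuous_on U g" "y \<in> ball x0 \<rho>" for g y
  proof (rule integrable_continuous)
    have "continuous_on (cbox 0 1) (\<lambda>t. case (y, t) of (y, t) \<Rightarrow> g (y + axis j (e t)) / e t)"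
      by (rule continuous_on_compose2[OF continuous_on_circle[OF that(1), of j]])
         (use that(2) in \<open>auto intro!: continuous_on_Pair continuous_on_const continuous_on_id\<close>)
    then show "continuous_on (cbox 0 1) (\<lambda>t. g (y + axis j (e t)) / e t)"
      by simp
  qed
  have "((\<lambda>y. integral (cbox 0 1) (\<lambda>t. f (y + axis j (e t)) / e t)) has_derivative
       blinfun_apply (integral (cbox 0 1) (D x0))) (at x0 within ball x0 \<rho>)"
    using hd D x0 contD int[OF holo_on_continuous[OF assms(1)]]
    by (intro leibniz_rule) (auto intro: has_derivative_at_withinI)
  then have "((\<lambda>y. integral (cbox 0 1) (\<lambda>t. f (y + axis j (e t)) / e t)) has_derivative
       blinfun_apply (integral (cbox 0 1) (D x0))) (at x0)"
    using x0 by (simp add: at_within_open[of _ "ball x0 \<rho>"])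
  then have "(cpartial j f has_derivative blinfun_apply (integral (cbox 0 1) (D x0))) (at x0)"
    by (rule has_derivative_transform_within_open[of _ _ _ _ "ball x0 \<rho>"])
       (use x0 in \<open>auto simp: cpartial_circle[OF assms(1)]\<close>)
  moreover have "blinfun_apply (integral (cbox 0 1) (D x0)) =
       (\<lambda>h. \<Sum>k\<in>UNIV. h $ k * integral (cbox 0 1) (\<lambda>t. cpartial k f (x0 + axis j (e t)) / e t))"
  proof
    fix h
    have "continuous_on (cbox 0 1) (\<lambda>t. case (x0, t) of (y, t) \<Rightarrow> D y t)"
      by (rule continuous_on_compose2[OF contD])
         (use x0 in \<open>auto intro!: continuous_on_Pair continuous_on_const continuous_on_id\<close>)
    then have "D x0 integrable_on cbox 0 1"
      by (intro integrable_continuous) simp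
    then have "blinfun_apply (integral (cbox 0 1) (D x0)) h = integral (cbox 0 1) (\<lambda>t. D x0 t h)"
      by (rule blinfun_apply_integral)
    also have "\<dots> = integral (cbox 0 1)
         (\<lambda>t. \<Sum>k\<in>UNIV. h $ k * (cpartial k f (x0 + axis j (e t)) / e t))"
      by (simp add: D[OF x0] sum_divide_distrib)
    also have "\<dots> = (\<Sum>k\<in>UNIV. integral (cbox 0 1) (\<lambda>t. h $ k * (cpartial k f (x0 + axis j (e t)) / e t)))"
      by (intro integral_sum integrable_on_mult_right int[OF cont x0]) simp
    finally show "blinfun_apply (integral (cbox 0 1) (D x0)) h =
       (\<Sum>k\<in>UNIV. h $ k * integral (cbox 0 1) (\<lambda>t. cpartial k f (x0 + axis j (e t)) / e t))"
      by (simp only: integral_mult_right)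
  qed
  ultimately show ?thesis by simp
qed

end

lemma open_contains_cball_double:
  fixes U :: "'a::metric_space set"
  assumes "open U" "x \<in> U" obtains \<rho> where "\<rho> > 0" "cball x (2 * \<rho>) \<subseteq> U"
proof -
  obtain r where "r > 0" "cball x r \<subseteq> U" using assms open_contains_cball by blast
  then show thesis using that[of "r / 2"] by simp
qed

lemma holo_on_cpartial_continuous:
  assumes "holo_on f U" "open U" shows "continuous_on U (cpartial j f)"
proof (rule continuous_at_imp_continuous_on, rule ballI)
  fix x assume "x \<in> U"
  then obtain \<rho> where \<rho>: "\<rho> > 0" "cball x (2 * \<rho>) \<subseteq> U"
    using assms(2) open_contains_cball_double by blast
  from cpartial_continuous_ball[OF this assms(1)]
  show "isCont (cpartial j f) x" using \<rho>(1) by (simp add: continuous_on_eq_continuous_at)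
qed

lemma holo_on_cpartial:
  assumes "holo_on f U" "open U" shows "holo_on (cpartial j f) U"
  unfolding holo_on_def
proof
  fix x assume "x \<in> U"
  then obtain \<rho> where \<rho>: "\<rho> > 0" "cball x (2 * \<rho>) \<subseteq> U"
    using assms(2) open_contains_cball_double by blast
  show "\<exists>L. (cpartial j f has_derivative L) (at x) \<and> (\<forall>c h. L (c *s h) = c * L h)"
    using cpartial_has_derivative[OF \<rho> assms(1) holo_on_cpartial_continuous[OF assms], of j]
    by (intro exI conjI allI) (assumption, simp add: sum_distrib_left mult.assoc)
qed

text \<open>The \<open>i\<close>-th coefficient of the derivative of \<open>cpartial j f\<close> is
  the Cauchy integral of \<open>cpartial i f\<close> in direction \<open>j\<close>. As
  \<open>cpartial i f\<close> is holomorphic, that integral is also its \<open>j\<close>-th partial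
  derivative.\<close>

lemma cpartial_commute:
  assumes "holo_on f U" "open U" "x \<in> U"
  shows "cpartial i (cpartial j f) x = cpartial j (cpartial i f) x"
proof -
  obtain \<rho> where \<rho>: "\<rho> > 0" "cball x (2 * \<rho>) \<subseteq> U"
    using assms(2,3) open_contains_cball_double by blast
  show ?thesis
    using cpartial_eqI[OF cpartial_has_derivative[OF \<rho> assms(1) holo_on_cpartial_continuous[OF assms(1,2)], of j], of i]
      cpartial_circle[OF \<rho> holo_on_cpartial[OF assms(1,2)], of x j i] \<rho>(1)
    by simp
qed

section \<open>Joint eigenvectors of commuting operators\<close>

text \<open>The operators are total functions with algebraic laws on \<open>V\<close> only, because
  partial differentiation is linear and commutative on holomorphic functions but not on arbitrary
  ones.\<close>

locale commuting_family = vector_space scale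
  for scale :: "'a::field \<Rightarrow> 'v::ab_group_add \<Rightarrow> 'v" +
  fixes V :: "'v set" and T :: "'i \<Rightarrow> 'v \<Rightarrow> 'v"
  assumes subspace_V: "subspace V"
    and T_closed: "v \<in> V \<Longrightarrow> T l v \<in> V"
    and T_add: "v \<in> V \<Longrightarrow> v' \<in> V \<Longrightarrow> T l (v + v') = T l v + T l v'"
    and T_scale: "v \<in> V \<Longrightarrow> T l (scale a v) = scale a (T l v)"
    and T_comm: "v \<in> V \<Longrightarrow> T l (T m v) = T m (T l v)"
begin

lemmas V_rules = subspace_add[OF subspace_V] subspace_scale[OF subspace_V]
  subspace_diff[OF subspace_V] subspace_0[OF subspace_V]

definition joint_eigen :: "('i \<Rightarrow> 'a) \<Rightarrow> 'v \<Rightarrow> bool" where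
  "joint_eigen w v \<longleftrightarrow> v \<in> V \<and> (\<forall>l. T l v = scale (w l) v)"

definition factors :: "('i \<times> 'a) list \<Rightarrow> 'v \<Rightarrow> 'v" where
  "factors xs v = foldr (\<lambda>(l, k) g. T l g - scale k g) xs v"

lemma factors_Nil [simp]: "factors [] v = v"
  and factors_Cons [simp]: "factors ((l, k) # xs) v = T l (factors xs v) - scale k (factors xs v)"
  and factors_append: "factors (xs @ ys) v = factors xs (factors ys v)"
  by (simp_all add: factors_def)

lemma factors_closed: "v \<in> V \<Longrightarrow> factors xs v \<in> V"
  by (induction xs) (auto intro!: V_rules T_closed)

lemma factors_add: "v \<in> V \<Longrightarrow> v' \<in> V \<Longrightarrow> factors xs (v + v') = factors xs v + factors xs v'"
  by (induction xs) (auto simp: T_add factors_closed algebra_simps)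

lemma factors_scale: "v \<in> V \<Longrightarrow> factors xs (scale a v) = scale a (factors xs v)"
  by (induction xs) (auto simp: T_scale factors_closed algebra_simps)

lemma factors_zero: "factors xs 0 = 0"
  using factors_scale[of 0 xs 0] V_rules by simp

lemma factors_diff:
  assumes "v \<in> V" "v' \<in> V" shows "factors xs (v - v') = factors xs v - factors xs v'"
  using factors_add[of "v - v'" v' xs] assms V_rules by (simp add: algebra_simps)

lemma T_diff: "v \<in> V \<Longrightarrow> v' \<in> V \<Longrightarrow> T l (v - v') = T l v - T l v'"
  using T_add[of "v - v'" v' l] V_rules by (simp add: algebra_simps)

lemma T_factors: "v \<in> V \<Longrightarrow> T l (factors xs v) = factors xs (T l v)"
  by (induction xs) (auto simp: T_diff T_scale T_comm[of _ l] factors_closed T_closed V_rules)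

lemma factors_comm: "v \<in> V \<Longrightarrow> factors xs (factors ys v) = factors ys (factors xs v)"
  by (induction xs arbitrary: v)
     (auto simp: T_factors factors_closed factors_diff factors_scale T_closed V_rules)

lemma factors_joint_eigen:
  assumes "joint_eigen w v"
  shows "factors xs v = scale (\<Prod>(l, k)\<leftarrow>xs. w l - k) v"
  using assms by (induction xs) (auto simp: joint_eigen_def T_scale algebra_simps)

lemma joint_eigen_scale: "joint_eigen w v \<Longrightarrow> joint_eigen w (scale a v)"
  by (auto simp: joint_eigen_def T_scale V_rules mult.commute)

lemma span_subset_V: "span {h. \<exists>w. joint_eigen w h \<and> Q w} \<subseteq> V"
  by (rule span_minimal) (auto simp: joint_eigen_def subspace_V)

lemma factors_span_eq_0:
  assumes "\<And>w. Q w \<Longrightarrow> \<exists>(l, k)\<in>set xs. w l = k"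
    and "h \<in> span {h. \<exists>w. joint_eigen w h \<and> Q w}"
  shows "factors xs h = 0"
proof -
  have "factors xs h = 0 \<and> h \<in> V"
    using assms(2)
  proof (induction rule: span_induct_alt)
    case base
    show ?case using V_rules by (simp add: factors_zero)
  next
    case (step a x y)
    then obtain w where w: "joint_eigen w x" "Q w" by blast
    have "(\<Prod>(l, k)\<leftarrow>xs. w l - k) = 0"
      using assms(1)[OF w(2)] by (force simp: prod_list_zero_iff)
    moreover have "x \<in> V" using w(1) by (simp add: joint_eigen_def)
    ultimately show ?case
      using step.IH w(1) by (simp add: factors_add factors_scale V_rules factors_joint_eigen)
  qed
  then show ?thesis ..
qed

text \<open>On a joint eigenvector the product acts as the scalar
  \<open>\<Prod>(l, k)\<leftarrow>xs. w l - k\<close>, which is nonzero here; dividing by it lifts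
  each generator, and span induction does the rest.\<close>

lemma factors_surj_span:
  assumes "\<And>w. Q w \<Longrightarrow> \<forall>(l, k)\<in>set xs. w l \<noteq> k"
    and "g \<in> span {h. \<exists>w. joint_eigen w h \<and> Q w}"
  shows "\<exists>g' \<in> span {h. \<exists>w. joint_eigen w h \<and> Q w}. factors xs g' = g"
  using assms(2)
proof (induction rule: span_induct_alt)
  case base
  show ?case using factors_zero span_zero by (intro bexI[of _ 0])
next
  case (step a x y)
  then obtain w where w: "joint_eigen w x" "Q w" by blast
  obtain y' where y': "y' \<in> span {h. \<exists>w. joint_eigen w h \<and> Q w}" "factors xs y' = y"
    using step.IH by blast
  define s where "s = (\<Prod>(l, k)\<leftarrow>xs. w l - k)"
  have s: "s \<noteq> 0"
    using assms(1)[OF w(2)] by (force simp: s_def prod_list_zero_iff)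
  have mem: "x \<in> V" "y' \<in> V"
    using w(1) subsetD[OF span_subset_V[of Q] y'(1)] unfolding joint_eigen_def by blast+
  have "factors xs (scale (a / s) x + y') = scale a x + y"
    using s mem w(1) y'(2)
    by (simp add: factors_add factors_scale V_rules factors_joint_eigen flip: s_def)
  moreover have "scale (a / s) x + y' \<in> span {h. \<exists>w. joint_eigen w h \<and> Q w}"
    using w by (intro span_add[OF span_scale[OF span_base] y'(1)]) auto
  ultimately show ?case by blast
qed

text \<open>Each factor \<open>T l - k\<close> plays the role of a line, and \<open>generic_lines\<close> says that a line of
  the first family meets a line of the second one transversally, away from all other lines.\<close>

definition generic_lines :: "('i \<times> 'a) list \<Rightarrow> ('i \<times> 'a) list \<Rightarrow> bool" where
  "generic_lines ps qs \<longleftrightarrow> distinct (ps @ qs) \<and>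
     (\<forall>(i, k)\<in>set ps. \<forall>(j, k')\<in>set qs. \<forall>h\<in>V. T i h = scale k h \<longrightarrow> T j h = scale k' h \<longrightarrow>
        (\<exists>w. joint_eigen w h \<and> w i = k \<and> w j = k' \<and>
          (\<forall>(l, m)\<in>set ps \<union> set qs - {(i, k), (j, k')}. w l \<noteq> m)))"

lemma generic_linesI:
  assumes "distinct (ps @ qs)"
    and "\<And>i k j k' h. (i, k) \<in> set ps \<Longrightarrow> (j, k') \<in> set qs \<Longrightarrow> h \<in> V \<Longrightarrow>
      T i h = scale k h \<Longrightarrow> T j h = scale k' h \<Longrightarrow>
      \<exists>w. joint_eigen w h \<and> w i = k \<and> w j = k' \<and>
          (\<forall>(l, m)\<in>set ps \<union> set qs - {(i, k), (j, k')}. w l \<noteq> m)"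
  shows "generic_lines ps qs"
  unfolding generic_lines_def by (intro conjI assms(1)) (clarify, rule assms(2))

lemma generic_linesD:
  assumes "generic_lines ps qs" "(i, k) \<in> set ps" "(j, k') \<in> set qs" "h \<in> V"
    "T i h = scale k h" "T j h = scale k' h"
  obtains w where "joint_eigen w h" "w i = k" "w j = k'"
    "\<And>l m. (l, m) \<in> set ps \<union> set qs - {(i, k), (j, k')} \<Longrightarrow> w l \<noteq> m"
  using assms unfolding generic_lines_def by fastforce

lemma generic_lines_sub:
  assumes "generic_lines ps qs" "set ps' \<subseteq> set ps" "set qs' \<subseteq> set qs" "distinct ps'" "distinct qs'"
  shows "generic_lines ps' qs'"
proof (rule generic_linesI)
  show "distinct (ps' @ qs')" using assms by (auto simp: generic_lines_def)
  fix i k j k' h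
  assume *: "(i, k) \<in> set ps'" "(j, k') \<in> set qs'" "h \<in> V" "T i h = scale k h" "T j h = scale k' h"
  obtain w where "joint_eigen w h" "w i = k" "w j = k'"
      "\<And>l m. (l, m) \<in> set ps \<union> set qs - {(i, k), (j, k')} \<Longrightarrow> w l \<noteq> m"
    by (rule generic_linesD[OF assms(1) subsetD[OF assms(2) *(1)] subsetD[OF assms(3) *(2)] *(3-5)], rule that)
  then show "\<exists>w. joint_eigen w h \<and> w i = k \<and> w j = k' \<and>
      (\<forall>(l, m)\<in>set ps' \<union> set qs' - {(i, k), (j, k')}. w l \<noteq> m)"
    using assms(2,3) by (intro exI[of _ w]) auto
qed

text \<open>Peel off the outermost factor \<open>q\<close>: the vector
  \<open>g = factors qs f\<close> lies on the line \<open>(i, k)\<close> and on \<open>q\<close>,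
  hence is a joint eigenvector, and its weight avoids all lines of \<open>qs\<close>. A multiple
  \<open>h\<close> of \<open>g\<close> therefore satisfies \<open>factors qs h = g\<close>, and
  \<open>f - h\<close> is killed by the shorter list. The conditions on \<open>w\<close> in the
  conclusion are what the next decomposition consumes.\<close>

lemma single_line_decomposition:
  assumes "generic_lines ((i, k) # ps) qs" "f \<in> V" "T i f = scale k f" "factors qs f = 0"
  shows "f \<in> span {h. \<exists>w. joint_eigen w h \<and> w i = k \<and> (\<exists>(j, k')\<in>set qs. w j = k') \<and>
                        (\<forall>(l, m)\<in>set ps. w l \<noteq> m)}"
  using assms
proof (induction qs arbitrary: f)
  case Nil
  then show ?case using span_zero by simp
next
  case (Cons q qs)
  obtain j k' where q: "q = (j, k')" by force
  let ?X = "\<lambda>qs. {h. \<exists>w. joint_eigen w h \<and> w i = k \<and> (\<exists>(j, k')\<in>set qs. w j = k') \<and>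
                        (\<forall>(l, m)\<in>set ps. w l \<noteq> m)}"
  define g where "g = factors qs f"
  have g: "g \<in> V" "T i g = scale k g" "T j g = scale k' g"
    using Cons.prems
    by (auto simp: g_def q factors_closed T_factors factors_scale)
  then obtain w where w: "joint_eigen w g" "w i = k" "w j = k'"
      and w': "\<And>l m. (l, m) \<in> set ps \<union> set qs \<Longrightarrow> w l \<noteq> m"
  proof -
    obtain w where w: "joint_eigen w g" "w i = k" "w j = k'"
      and w': "\<And>l m. (l, m) \<in> set ((i, k) # ps) \<union> set (q # qs) - {(i, k), (j, k')} \<Longrightarrow> w l \<noteq> m"
      using generic_linesD[OF Cons.prems(1), of i k j k'] g q by auto
    have "distinct (((i, k) # ps) @ (q # qs))"
      using Cons.prems(1) by (simp add: generic_lines_def)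
    then show thesis using that[OF w] w' q by auto
  qed
  define s where "s = (\<Prod>(l, m)\<leftarrow>qs. w l - m)"
  have s: "s \<noteq> 0"
    using w' by (force simp: s_def prod_list_zero_iff)
  define h where "h = scale (1 / s) g"
  have h: "joint_eigen w h" "h \<in> V" "T i h = scale k h"
    using w g by (auto simp: h_def joint_eigen_scale T_scale V_rules mult.commute)
  have dist: "distinct ps" "distinct qs" "(i, k) \<notin> set ps"
    using Cons.prems(1) by (auto simp: generic_lines_def)
  have "factors qs h = g"
    using s g w(1) by (simp add: h_def factors_scale factors_joint_eigen flip: s_def)
  then have "f - h \<in> span (?X qs)"
    using Cons.prems h
    by (intro Cons.IH generic_lines_sub[OF Cons.prems(1)])
       (auto simp: g_def factors_diff T_diff scale_right_diff_distrib V_rules dist)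
  then have "f - h \<in> span (?X (q # qs))"
    by (rule set_mp[OF span_mono, rotated]) fastforce
  moreover have "h \<in> span (?X (q # qs))"
    using h w w' q by (intro span_base) auto
  ultimately have "(f - h) + h \<in> span (?X (q # qs))"
    by (rule span_add)
  then show ?case by simp
qed

text \<open>The same peeling, one line of \<open>ps\<close> at a time. Now
  \<open>g = factors ps f\<close> is a sum of eigenvectors on the line \<open>p\<close>, whose
  weights avoid \<open>ps\<close>, so it lifts to such a sum \<open>h\<close> with
  \<open>factors ps h = g\<close>. These weights lie on lines of \<open>qs\<close>, so
  \<open>qs\<close> kills \<open>h\<close> and the induction continues with
  \<open>f - h\<close>.\<close>

lemma joint_eigen_decomposition:
  assumes "generic_lines ps qs" "f \<in> V" "factors ps f = 0" "factors qs f = 0"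
  shows "f \<in> span {h. \<exists>w. joint_eigen w h}"
  using assms
proof (induction ps arbitrary: f)
  case Nil
  then show ?case using span_zero by simp
next
  case (Cons p ps)
  obtain i k where p: "p = (i, k)" by force
  let ?Q = "\<lambda>w. w i = k \<and> (\<exists>(j, k')\<in>set qs. w j = k') \<and> (\<forall>(l, m)\<in>set ps. w l \<noteq> m)"
  let ?S = "span {h. \<exists>w. joint_eigen w h \<and> ?Q w}"
  define g where "g = factors ps f"
  have g: "g \<in> V" "T i g = scale k g" "factors qs g = 0"
    using Cons.prems
    by (auto simp: g_def p factors_closed factors_comm[of f qs] factors_zero)
  then have "g \<in> ?S"
    using Cons.prems(1) unfolding p by (intro single_line_decomposition)
  then obtain h where h: "h \<in> ?S" "factors ps h = g"
    using factors_surj_span[of ?Q ps g] by blast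
  have dist: "distinct ps" "distinct qs"
    using Cons.prems(1) by (auto simp: generic_lines_def)
  have "h \<in> V" by (rule subsetD[OF span_subset_V[of ?Q] h(1)])
  moreover have "factors qs h = 0"
    using factors_span_eq_0[of ?Q qs h] h(1) by blast
  ultimately have "f - h \<in> span {h. \<exists>w. joint_eigen w h}"
    using Cons.prems h(2)
    by (intro Cons.IH generic_lines_sub[OF Cons.prems(1)])
       (auto simp: g_def factors_diff V_rules dist)
  moreover have "h \<in> span {h. \<exists>w. joint_eigen w h}"
    using h(1) by (rule set_mp[OF span_mono, rotated]) blast
  ultimately have "(f - h) + h \<in> span {h. \<exists>w. joint_eigen w h}"
    by (rule span_add)
  then show ?case by simp
qed

end

section \<open>Linear relations between the operators and transversality of lines\<close>

context commuting_family
begin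

lemma V_sum: "(\<And>l. l \<in> A \<Longrightarrow> F l \<in> V) \<Longrightarrow> sum F A \<in> V"
  by (rule subspace_sum[OF subspace_V])

lemma T_zero: "T l 0 = 0"
  using T_scale[of 0 l 0] V_rules by simp

lemma T_sum:
  assumes "\<And>l. l \<in> A \<Longrightarrow> F l \<in> V"
  shows "T m (sum F A) = (\<Sum>l\<in>A. T m (F l))"
  using assms
  by (induction A rule: infinite_finite_induct) (auto simp: T_zero T_add V_sum)

text \<open>Each relation is a linear combination of the operators and scalars, so it commutes with
  every \<open>T m\<close> and its kernel is stable. The Euler relations can thus be built into the
  ambient space, where they hold for every vector and not just for the given solution.\<close>

lemma commuting_family_relations:
  fixes c :: "'i \<Rightarrow> 'a"
  shows "commuting_family scale
     {h \<in> V. \<forall>\<gamma>\<in>\<Gamma>. (\<Sum>l\<in>S. scale (\<gamma> l) (T l h - scale (c l) h)) = 0} T"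
    (is "commuting_family scale ?W T")
proof unfold_locales
  define R where "R \<gamma> h = (\<Sum>l\<in>S. scale (\<gamma> l) (T l h - scale (c l) h))" for \<gamma> h
  have R_add: "R \<gamma> (h + h') = R \<gamma> h + R \<gamma> h'" if "h \<in> V" "h' \<in> V" for \<gamma> h h'
    using that by (simp add: R_def T_add algebra_simps sum.distrib sum_subtractf)
  have R_scale: "R \<gamma> (scale a h) = scale a (R \<gamma> h)" if "h \<in> V" for \<gamma> h a
    using that by (simp add: R_def T_scale algebra_simps scale_sum_right)
  have R_T: "R \<gamma> (T m h) = T m (R \<gamma> h)" if "h \<in> V" for \<gamma> h m
  proof -
    have "T m (R \<gamma> h) = (\<Sum>l\<in>S. T m (scale (\<gamma> l) (T l h - scale (c l) h)))"
      unfolding R_def using that by (intro T_sum V_rules T_closed)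
    also have "\<dots> = R \<gamma> (T m h)"
      unfolding R_def using that
      by (intro sum.cong refl) (simp add: T_scale T_diff T_closed V_rules T_comm[of h m])
    finally show ?thesis by simp
  qed
  have R_0: "R \<gamma> 0 = 0" for \<gamma>
    by (simp add: R_def T_zero)
  have W: "?W = {h \<in> V. \<forall>\<gamma>\<in>\<Gamma>. R \<gamma> h = 0}" by (simp add: R_def)
  show "subspace ?W"
    unfolding W subspace_def using V_rules by (simp add: R_0 R_add R_scale)
  show "T l v \<in> ?W" if "v \<in> ?W" for v l
    using that unfolding W by (simp add: R_T T_closed T_zero)
qed (auto simp: T_add T_scale T_comm)

text \<open>On \<open>h\<close> the operators \<open>T l - c l\<close> obey every integer relation
  among the rows \<open>(p l, q l)\<close> of a two-column matrix. If rows \<open>i\<close> and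
  \<open>j\<close> were parallel, a relation supported on them would make an integer combination of
  the \<open>c l\<close> an integer. Otherwise they determine all other eigenvalues, and a natural
  number among those would produce such a combination again.\<close>

lemma transversal_intersection:
  fixes c :: "'i \<Rightarrow> 'a" and p q :: "'i \<Rightarrow> int"
  assumes char0: "\<And>m::int. of_int m = (0::'a) \<Longrightarrow> m = 0"
    and fin: "finite (UNIV :: 'i set)"
    and rel: "\<And>h \<gamma>. h \<in> V \<Longrightarrow> (\<Sum>l\<in>UNIV. \<gamma> l * p l) = 0 \<Longrightarrow> (\<Sum>l\<in>UNIV. \<gamma> l * q l) = 0 \<Longrightarrow>
                  (\<Sum>l\<in>UNIV. scale (of_int (\<gamma> l)) (T l h - scale (c l) h)) = 0"
    and generic: "\<And>(\<gamma> :: 'i \<Rightarrow> int) m. (\<Sum>l\<in>UNIV. of_int (\<gamma> l) * c l) = of_int m \<Longrightarrow> \<gamma> = (\<lambda>_. 0)"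
    and ij: "i \<noteq> j" "p i \<noteq> 0"
    and h: "h \<in> V" "T i h = scale (of_nat k) h" "T j h = scale (of_nat k') h"
  shows "\<exists>w. joint_eigen w h \<and> w i = of_nat k \<and> w j = of_nat k' \<and>
             (\<forall>l. l \<noteq> i \<longrightarrow> l \<noteq> j \<longrightarrow> w l \<notin> \<nat>)"
proof (cases "h = 0")
  case True
  \<comment> \<open>For \<open>h = 0\<close> every function is a weight; -1 supplies the required
    non-natural value away from \<open>i\<close> and \<open>j\<close>.\<close>
  have "(-1 :: 'a) \<notin> \<nat>"
  proof
    assume "(-1 :: 'a) \<in> \<nat>"
    then obtain m where "(-1 :: 'a) = of_nat m" by (auto simp: Nats_def)
    then have "(of_int (int m + 1) :: 'a) = 0" by (simp flip: \<open>- 1 = of_nat m\<close>)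
    from char0[OF this] show False by simp
  qed
  then show ?thesis
    using True h(1) ij(1)
    by (intro exI[of _ "\<lambda>l. if l = i then of_nat k else if l = j then of_nat k' else - 1"])
       (auto simp: joint_eigen_def T_zero)
next
  case False
  have sum2: "(\<Sum>l\<in>UNIV. F l) = F i + F j" if "\<And>l. l \<noteq> i \<Longrightarrow> l \<noteq> j \<Longrightarrow> F l = 0"
    for F :: "'i \<Rightarrow> 'b::comm_monoid_add"
    using sum.mono_neutral_right[of UNIV "{i, j}" F] fin that ij(1) by auto
  have sum3: "(\<Sum>l\<in>UNIV. F l) = F i + (F j + F l)"
    if "\<And>m. m \<noteq> i \<Longrightarrow> m \<noteq> j \<Longrightarrow> m \<noteq> l \<Longrightarrow> F m = 0" "l \<noteq> i" "l \<noteq> j"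
    for F :: "'i \<Rightarrow> 'b::comm_monoid_add" and l
    using sum.mono_neutral_right[of UNIV "{i, j, l}" F] fin that ij(1) by auto
  define D where "D = p i * q j - p j * q i"
  have D: "D \<noteq> 0"
  proof
    assume D0: "D = 0"
    \<comment> \<open>This vector is orthogonal to \<open>p\<close> by construction and to
      \<open>q\<close> because \<open>D = 0\<close>; its entry \<open>- p i\<close> is nonzero,
      which contradicts genericity.\<close>
    define \<gamma> where "\<gamma> = (\<lambda>l. if l = i then p j else if l = j then - p i else 0)"
    have "(\<Sum>l\<in>UNIV. \<gamma> l * p l) = 0" "(\<Sum>l\<in>UNIV. \<gamma> l * q l) = 0"
      using D0 ij(1) by (subst sum2; simp add: \<gamma>_def D_def algebra_simps)+
    from rel[OF h(1) this]
    have "scale (of_int (p j)) (T i h - scale (c i) h) + scale (of_int (- p i)) (T j h - scale (c j) h) = 0"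
      using ij(1) by (subst (asm) sum2; simp add: \<gamma>_def)
    then have "scale (of_int (p j) * (of_nat k - c i) - of_int (p i) * (of_nat k' - c j)) h = 0"
      by (simp add: h algebra_simps)
    then have "of_int (p j) * (of_nat k - c i) - of_int (p i) * (of_nat k' - c j) = 0"
      using False by simp
    then have "(\<Sum>l\<in>UNIV. of_int (\<gamma> l) * c l) = of_int (p j * int k - p i * int k')"
      using ij(1) by (subst sum2; simp add: \<gamma>_def algebra_simps)
    from fun_cong[OF generic[OF this], of j] show False
      using ij by (simp add: \<gamma>_def split: if_splits)
  qed
  have D': "of_int D \<noteq> (0::'a)" using char0 D by blast
  \<comment> \<open>Cramer's rule in the plane: \<open>D\<close> times row \<open>l\<close> plus
    \<open>a l\<close> times row \<open>i\<close> plus \<open>b l\<close> times row \<open>j\<close>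
    is zero. Solving the corresponding relation on \<open>h\<close> for \<open>T l h\<close> gives
    the value of \<open>w l\<close> below.\<close>
  define a where "a l = p j * q l - p l * q j" for l
  define b where "b l = p l * q i - p i * q l" for l
  define w where "w l = (if l = i then of_nat k else if l = j then of_nat k' else
      c l - (of_int (a l) * (of_nat k - c i) + of_int (b l) * (of_nat k' - c j)) / of_int D)" for l
  have other: "T l h = scale (w l) h \<and> w l \<notin> \<nat>" if l: "l \<noteq> i" "l \<noteq> j" for l
  proof
    define \<gamma> where "\<gamma> = (\<lambda>m. if m = l then D else if m = i then a l else if m = j then b l else 0)"
    have "(\<Sum>m\<in>UNIV. \<gamma> m * p m) = 0" "(\<Sum>m\<in>UNIV. \<gamma> m * q m) = 0"
      using l ij(1) by (subst sum3[of l]; simp add: \<gamma>_def D_def a_def b_def algebra_simps)+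
    from rel[OF h(1) this]
    have "scale (of_int (a l)) (T i h - scale (c i) h) + (scale (of_int (b l)) (T j h - scale (c j) h)
            + scale (of_int D) (T l h - scale (c l) h)) = 0"
      using l ij(1) by (subst (asm) sum3[of l]; simp add: \<gamma>_def)
    then have "scale (of_int D) (T l h - scale (c l) h) =
        scale (- (of_int (a l) * (of_nat k - c i) + of_int (b l) * (of_nat k' - c j))) h"
      by (simp add: h algebra_simps eq_neg_iff_add_eq_0)
    then have "scale (1 / of_int D) (scale (of_int D) (T l h - scale (c l) h)) = scale (1 / of_int D) (
        scale (- (of_int (a l) * (of_nat k - c i) + of_int (b l) * (of_nat k' - c j))) h)"
      by simp
    then have "T l h - scale (c l) h = scale (1 / of_int D *
        - (of_int (a l) * (of_nat k - c i) + of_int (b l) * (of_nat k' - c j))) h"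
      unfolding scale_scale using D' by simp
    also have "1 / of_int D * - (of_int (a l) * (of_nat k - c i) + of_int (b l) * (of_nat k' - c j))
        = w l - c l"
      using l D' by (simp add: w_def divide_simps)
    finally have "T l h - scale (c l) h = scale (w l - c l) h" .
    then show "T l h = scale (w l) h" by (simp add: algebra_simps)
    show "w l \<notin> \<nat>"
    proof
      assume "w l \<in> \<nat>"
      then obtain m where "w l = of_nat m" by (auto simp: Nats_def)
      then have "(\<Sum>l\<in>UNIV. of_int (\<gamma> l) * c l) = of_int (D * int m + a l * int k + b l * int k')"
        using l ij(1) D' by (subst sum3[of l]; simp add: \<gamma>_def w_def field_simps)
      from fun_cong[OF generic[OF this], of l] D show False by (simp add: \<gamma>_def)
    qed
  qed
  have "T l h = scale (w l) h" for l
    using other[of l] h by (cases "l = i \<or> l = j") (auto simp: w_def)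
  then show ?thesis
    using other h(1) ij(1) by (intro exI[of _ w]) (auto simp: joint_eigen_def w_def)
qed

end

section \<open>The Weyl algebra relations and falling factorials of Euler operators\<close>

locale weyl_family = vector_space scale
  for scale :: "'a::field \<Rightarrow> 'v::ab_group_add \<Rightarrow> 'v" +
  fixes V :: "'v set" and X d :: "'i \<Rightarrow> 'v \<Rightarrow> 'v"
  assumes subspace_V: "subspace V"
    and X_closed: "v \<in> V \<Longrightarrow> X l v \<in> V"
    and d_closed: "v \<in> V \<Longrightarrow> d l v \<in> V"
    and X_add: "v \<in> V \<Longrightarrow> v' \<in> V \<Longrightarrow> X l (v + v') = X l v + X l v'"
    and d_add: "v \<in> V \<Longrightarrow> v' \<in> V \<Longrightarrow> d l (v + v') = d l v + d l v'"
    and X_scale: "v \<in> V \<Longrightarrow> X l (scale a v) = scale a (X l v)"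
    and d_scale: "v \<in> V \<Longrightarrow> d l (scale a v) = scale a (d l v)"
    and X_comm: "v \<in> V \<Longrightarrow> X l (X m v) = X m (X l v)"
    and d_comm: "v \<in> V \<Longrightarrow> d l (d m v) = d m (d l v)"
    and d_X: "v \<in> V \<Longrightarrow> d l (X m v) = X m (d l v) + (if l = m then v else 0)"
begin

definition euler :: "'i \<Rightarrow> 'v \<Rightarrow> 'v" where "euler l v = X l (d l v)"

sublocale commuting_family scale V euler
proof unfold_locales
  show "euler l (euler m v) = euler m (euler l v)" if v: "v \<in> V" for v l m
  proof (cases "l = m")
    case False
    then have "euler l (euler m v) = X l (X m (d l (d m v)))"
      "euler m (euler l v) = X m (X l (d m (d l v)))"
      using v by (auto simp: euler_def d_X d_closed)
    then show ?thesis using v by (simp add: X_comm[of _ l] d_comm[of _ l] d_closed)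
  qed simp
qed (auto simp: euler_def subspace_V X_closed d_closed X_add d_add X_scale d_scale)

definition dpow :: "'i list \<Rightarrow> ('i \<Rightarrow> nat) \<Rightarrow> 'v \<Rightarrow> 'v" where
  "dpow xs \<beta> v = foldr (\<lambda>j g. (d j ^^ \<beta> j) g) xs v"

lemma dpow_Nil [simp]: "dpow [] \<beta> v = v"
  and dpow_Cons [simp]: "dpow (j # xs) \<beta> v = (d j ^^ \<beta> j) (dpow xs \<beta> v)"
  by (simp_all add: dpow_def)

lemma iter_closed: "v \<in> V \<Longrightarrow> (d j ^^ m) v \<in> V" "v \<in> V \<Longrightarrow> (X j ^^ m) v \<in> V"
  by (induction m) (auto simp: X_closed d_closed)

lemma dpow_closed: "v \<in> V \<Longrightarrow> dpow xs \<beta> v \<in> V"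
  by (induction xs) (auto simp: iter_closed)

lemma d_zero: "d j 0 = 0" and X_zero: "X j 0 = 0"
  using d_scale[of 0 j 0] X_scale[of 0 j 0] V_rules by simp_all

lemma iter_zero: "(d j ^^ m) 0 = 0" "(X j ^^ m) 0 = 0"
  by (induction m) (auto simp: d_zero X_zero)

lemma dpow_zero: "dpow xs \<beta> 0 = 0"
  by (induction xs) (auto simp: iter_zero)

lemma d_iter: "v \<in> V \<Longrightarrow> d i ((d j ^^ m) v) = (d j ^^ m) (d i v)"
  by (induction m) (auto simp: d_comm[of _ i] iter_closed)

lemma d_dpow: "v \<in> V \<Longrightarrow> d i (dpow xs \<beta> v) = dpow xs \<beta> (d i v)"
  by (induction xs) (auto simp: d_iter dpow_closed)

lemma iter_dpow: "v \<in> V \<Longrightarrow> (d i ^^ m) (dpow xs \<beta> v) = dpow xs \<beta> ((d i ^^ m) v)"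
  by (induction m) (auto simp: d_dpow iter_closed)

lemma dpow_add:
  assumes "v \<in> V" shows "dpow xs (\<lambda>j. \<beta> j + \<gamma> j) v = dpow xs \<beta> (dpow xs \<gamma> v)"
  by (induction xs) (use assms in \<open>auto simp: funpow_add iter_dpow dpow_closed iter_closed\<close>)

lemma dpow_comm: "v \<in> V \<Longrightarrow> dpow xs \<beta> (dpow xs \<gamma> v) = dpow xs \<gamma> (dpow xs \<beta> v)"
  using dpow_add[of v xs \<beta> \<gamma>] dpow_add[of v xs \<gamma> \<beta>] by (simp add: add.commute)

text \<open>One copy of \<open>\<beta>\<close> is traded for one copy of \<open>\<gamma>\<close> at
  a time, since the derivatives commute. This moves the nilpotency from \<open>pospart u\<close> to
  \<open>negpart u\<close>.\<close>

lemma dpow_mult_eq: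
  assumes "v \<in> V" "dpow xs \<beta> v = dpow xs \<gamma> v"
  shows "dpow xs (\<lambda>j. N * \<beta> j) v = dpow xs (\<lambda>j. N * \<gamma> j) v"
proof (induction N)
  case 0
  then show ?case by simp
next
  case (Suc N)
  have "dpow xs (\<lambda>j. Suc N * \<beta> j) v = dpow xs (\<lambda>j. N * \<beta> j) (dpow xs \<beta> v)"
    using dpow_add[OF assms(1), of xs "\<lambda>j. N * \<beta> j" \<beta>] by (simp add: add.commute)
  also have "\<dots> = dpow xs \<gamma> (dpow xs (\<lambda>j. N * \<beta> j) v)"
    by (simp add: assms dpow_comm)
  also have "\<dots> = dpow xs (\<lambda>j. Suc N * \<gamma> j) v"
    using dpow_add[OF assms(1), of xs \<gamma> "\<lambda>j. N * \<gamma> j"] by (simp add: Suc.IH add.commute)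
  finally show ?case .
qed

lemma dpow_eq_0_mono:
  assumes "v \<in> V" "dpow xs \<beta> v = 0" "\<And>j. \<beta> j \<le> \<gamma> j"
  shows "dpow xs \<gamma> v = 0"
  using dpow_add[OF assms(1), of xs "\<lambda>j. \<gamma> j - \<beta> j" \<beta>] assms by (simp add: dpow_zero)

text \<open>The list form of the falling factorial of an Euler operator. Because of
  \<open>rev\<close>, \<open>falling j (Suc m)\<close> is \<open>falling j m\<close> with the new
  factor \<open>(j, of_nat m)\<close> in front, the shape that induction on \<open>m\<close>
  needs.\<close>

definition falling :: "'i \<Rightarrow> nat \<Rightarrow> ('i \<times> 'a) list" where
  "falling j m = map (\<lambda>k. (j, of_nat k)) (rev [0..<m])"

text \<open>Applied to \<open>(d j ^^ m) v\<close>, it says that subtracting \<open>m\<close> from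
  the Euler operator turns \<open>x\<^sup>m d\<^sup>m\<close> into
  \<open>x\<^sup>m\<^sup>+\<^sup>1 d\<^sup>m\<^sup>+\<^sup>1\<close>.\<close>

lemma euler_X_iter:
  "v \<in> V \<Longrightarrow> euler j ((X j ^^ m) v) = (X j ^^ Suc m) (d j v) + scale (of_nat m) ((X j ^^ m) v)"
  by (induction m)
     (auto simp: euler_def d_X iter_closed X_add X_scale X_closed d_closed V_rules algebra_simps)

lemma factors_falling: "v \<in> V \<Longrightarrow> factors (falling j m) v = (X j ^^ m) ((d j ^^ m) v)"
proof (induction m)
  case 0
  then show ?case by (simp add: falling_def)
next
  case (Suc m)
  then show ?case
    using euler_X_iter[of "(d j ^^ m) v" j m] by (simp add: falling_def iter_closed)
qed

lemma d_euler: "v \<in> V \<Longrightarrow> i \<noteq> j \<Longrightarrow> d i (euler j v) = euler j (d i v)"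
  by (simp add: euler_def d_X d_closed d_comm[of _ i])

lemma d_factors:
  assumes "v \<in> V" "i \<notin> fst ` set xs" shows "d i (factors xs v) = factors xs (d i v)"
  using assms(2)
proof (induction xs)
  case (Cons x xs)
  obtain j k where x: "x = (j, k)" by force
  have "d i (factors (x # xs) v) = d i (euler j (factors xs v)) + scale (- k) (d i (factors xs v))"
    using d_add[of "euler j (factors xs v)" "scale (- k) (factors xs v)" i] assms(1)
    by (simp add: x factors_closed T_closed V_rules d_scale del: scale_minus_left)
       (simp add: d_scale factors_closed assms)
  then show ?case using Cons by (simp add: x d_euler factors_closed assms)
qed simp

lemma iter_d_factors:
  "v \<in> V \<Longrightarrow> i \<notin> fst ` set xs \<Longrightarrow> (d i ^^ m) (factors xs v) = factors xs ((d i ^^ m) v)"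
  by (induction m) (auto simp: d_factors iter_closed)

text \<open>Up to a monomial factor, the operator \<open>d\<^sup>\<beta>\<close> is a product of shifted Euler operators:
  \<open>x\<^sup>m d\<^sup>m = \<theta> (\<theta> - 1) \<dots> (\<theta> - m + 1)\<close>.\<close>

lemma factors_falling_eq_0:
  assumes "distinct xs" "v \<in> V" "dpow xs \<beta> v = 0"
  shows "factors (concat (map (\<lambda>j. falling j (\<beta> j)) xs)) v = 0"
  using assms
proof (induction xs arbitrary: v)
  case (Cons j xs)
  let ?C = "concat (map (\<lambda>j. falling j (\<beta> j)) xs)"
  have j: "j \<notin> fst ` set ?C" using Cons.prems(1) by (auto simp: falling_def)
  \<comment> \<open>Derivatives in \<open>j\<close> commute with derivatives and Euler factors in
    the other variables, so they can be moved inward onto \<open>v\<close> and the induction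
    hypothesis used there.\<close>
  have "dpow xs \<beta> ((d j ^^ \<beta> j) v) = 0"
    using Cons.prems by (simp add: iter_dpow)
  then have "factors ?C ((d j ^^ \<beta> j) v) = 0"
    using Cons.prems by (intro Cons.IH) (auto simp: iter_closed)
  then show ?case
    using Cons.prems j by (simp add: factors_append factors_falling factors_closed iter_d_factors iter_zero)
qed simp

lemma distinct_falling:
  assumes "\<And>m n. of_nat m = (of_nat n :: 'a) \<Longrightarrow> m = n" "distinct xs"
  shows "distinct (concat (map (\<lambda>j. falling j (\<beta> j)) xs))"
  using assms(2) by (induction xs) (auto simp: falling_def distinct_map inj_on_def assms(1))

end

section \<open>Euler operators on holomorphic functions\<close>

definition restrict_zero :: "'a set \<Rightarrow> ('a \<Rightarrow> complex) \<Rightarrow> 'a \<Rightarrow> complex" where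
  "restrict_zero U f = (\<lambda>x. if x \<in> U then f x else 0)"

definition fun_scale :: "complex \<Rightarrow> ('a \<Rightarrow> complex) \<Rightarrow> 'a \<Rightarrow> complex" where
  "fun_scale c f = (\<lambda>x. c * f x)"

text \<open>Functions are extended by 0 outside \<open>U\<close>, so that two of them agree on \<open>U\<close> iff they are equal.\<close>

definition holo_space :: "(complex^'n::finite) set \<Rightarrow> (complex^'n \<Rightarrow> complex) set" where
  "holo_space U = {f. holo_on f U \<and> (\<forall>x. x \<notin> U \<longrightarrow> f x = 0)}"

definition mult_coord :: "'n::finite \<Rightarrow> (complex^'n \<Rightarrow> complex) \<Rightarrow> complex^'n \<Rightarrow> complex" where
  "mult_coord j f = (\<lambda>x. x $ j * f x)"

definition partial_on :: "(complex^'n::finite) set \<Rightarrow> 'n \<Rightarrow> (complex^'n \<Rightarrow> complex) \<Rightarrow> complex^'n \<Rightarrow> complex" where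
  "partial_on U j f = restrict_zero U (cpartial j f)"

lemma holo_on_combination:
  assumes "holo_on f U" "holo_on g U"
  shows "holo_on (\<lambda>x. f x + g x) U" "holo_on (\<lambda>x. c * f x) U" "holo_on (\<lambda>x. x $ m * f x) U"
    and "x \<in> U \<Longrightarrow> cpartial j (\<lambda>x. f x + g x) x = cpartial j f x + cpartial j g x"
    and "x \<in> U \<Longrightarrow> cpartial j (\<lambda>x. c * f x) x = c * cpartial j f x"
    and "x \<in> U \<Longrightarrow> cpartial j (\<lambda>x. x $ m * f x) x = x $ m * cpartial j f x + (if j = m then f x else 0)"
proof -
  have 1: "((\<lambda>x. f x + g x) has_derivative (\<lambda>h. \<Sum>j\<in>UNIV. h $ j * (cpartial j f x + cpartial j g x))) (at x)"
    if "x \<in> U" for x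
    using has_derivative_add[OF assms[THEN holo_on_has_derivative, OF that]]
    by (simp add: sum.distrib distrib_left)
  show "holo_on (\<lambda>x. f x + g x) U"
    by (rule holo_onI[of _ _ "\<lambda>j x. cpartial j f x + cpartial j g x"]) (rule 1)
  show "x \<in> U \<Longrightarrow> cpartial j (\<lambda>x. f x + g x) x = cpartial j f x + cpartial j g x"
    by (rule cpartial_eqI[OF 1])
  have 2: "((\<lambda>x. c * f x) has_derivative (\<lambda>h. \<Sum>j\<in>UNIV. h $ j * (c * cpartial j f x))) (at x)"
    if "x \<in> U" for x
    using has_derivative_mult_right[OF holo_on_has_derivative[OF assms(1) that], of c]
    by (simp add: sum_distrib_left mult.left_commute)
  show "holo_on (\<lambda>x. c * f x) U"
    by (rule holo_onI[of _ _ "\<lambda>j x. c * cpartial j f x"]) (rule 2)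
  show "x \<in> U \<Longrightarrow> cpartial j (\<lambda>x. c * f x) x = c * cpartial j f x"
    by (rule cpartial_eqI[OF 2])
  have 3: "((\<lambda>x. x $ m * f x) has_derivative
      (\<lambda>h. \<Sum>j\<in>UNIV. h $ j * (x $ m * cpartial j f x + (if j = m then f x else 0)))) (at x)"
    if "x \<in> U" for x
  proof -
    have "((\<lambda>x. x $ m * f x) has_derivative
        (\<lambda>h. x $ m * (\<Sum>j\<in>UNIV. h $ j * cpartial j f x) + h $ m * f x)) (at x)"
      by (rule has_derivative_mult[OF bounded_linear_imp_has_derivative[OF bounded_linear_vec_nth]
            holo_on_has_derivative[OF assms(1) that]])
    moreover have "x $ m * (\<Sum>j\<in>UNIV. h $ j * cpartial j f x) + h $ m * f x =
        (\<Sum>j\<in>UNIV. h $ j * (x $ m * cpartial j f x + (if j = m then f x else 0)))" for h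
      by (simp add: distrib_left sum.distrib sum_distrib_left mult.left_commute
          if_distrib[of "\<lambda>a. _ * a"] cong: if_cong)
    ultimately show ?thesis by simp
  qed
  show "holo_on (\<lambda>x. x $ m * f x) U"
    by (rule holo_onI[of _ _ "\<lambda>j x. x $ m * cpartial j f x + (if j = m then f x else 0)"]) (rule 3)
  show "x \<in> U \<Longrightarrow> cpartial j (\<lambda>x. x $ m * f x) x = x $ m * cpartial j f x + (if j = m then f x else 0)"
    by (rule cpartial_eqI[OF 3])
qed

lemma holo_on_cong_open:
  assumes "open U" "holo_on f U" "\<And>x. x \<in> U \<Longrightarrow> f x = g x"
  shows "holo_on g U" and "x \<in> U \<Longrightarrow> cpartial j g x = cpartial j f x"
proof -
  have *: "(g has_derivative (\<lambda>h. \<Sum>j\<in>UNIV. h $ j * cpartial j f x)) (at x)" if "x \<in> U" for x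
    using holo_on_has_derivative[OF assms(2) that] assms(1) that assms(3)
    by (rule has_derivative_transform_within_open)
  show "holo_on g U" by (rule holo_onI[OF *])
  show "x \<in> U \<Longrightarrow> cpartial j g x = cpartial j f x" by (rule cpartial_eqI[OF *])
qed

lemma restrict_zero_holo:
  assumes "open U" "holo_on f U"
  shows "restrict_zero U f \<in> holo_space U"
    and "partial_on U j (restrict_zero U f) = restrict_zero U (cpartial j f)"
  using holo_on_cong_open[OF assms, of "restrict_zero U f"]
  by (auto simp: holo_space_def restrict_zero_def partial_on_def)

text \<open>The analytic input is \<open>holo_on_cpartial\<close>, for closure under
  differentiation, and \<open>cpartial_commute\<close>; the remaining laws are linearity and the
  product rule.\<close>

lemma holo_space_weyl:
  fixes U :: "(complex^'n::finite) set"
  assumes U: "open U"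
  shows "weyl_family fun_scale (holo_space U) mult_coord (partial_on U)"
proof -
  have vs: "vector_space (fun_scale :: complex \<Rightarrow> (complex^'n \<Rightarrow> complex) \<Rightarrow> _)"
    by unfold_locales (auto simp: fun_scale_def algebra_simps)
  interpret vs: vector_space "fun_scale :: complex \<Rightarrow> (complex^'n \<Rightarrow> complex) \<Rightarrow> _" by (rule vs)
  have mem: "holo_on f U" if "f \<in> holo_space U" for f using that by (simp add: holo_space_def)
  have zero: "holo_on (\<lambda>x::complex^'n. 0) U"
    by (rule holo_onI[of _ _ "\<lambda>_ _. 0"]) simp
  have partial_mem: "partial_on U j f \<in> holo_space U" if "f \<in> holo_space U" for f j
    unfolding partial_on_def
    using restrict_zero_holo(1)[OF U holo_on_cpartial[OF mem[OF that] U]] .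
  show ?thesis
  proof (intro weyl_family.intro[OF vs] weyl_family_axioms.intro)
    show "module.subspace fun_scale (holo_space U)"
      unfolding vs.subspace_def
    proof (intro conjI ballI allI)
      show "0 \<in> holo_space U"
        using zero by (simp add: holo_space_def zero_fun_def)
      fix f g :: "complex^'n \<Rightarrow> complex" and c :: complex
      assume f: "f \<in> holo_space U"
      show "fun_scale c f \<in> holo_space U"
        using f holo_on_combination(2)[OF mem[OF f] mem[OF f]] by (simp add: holo_space_def fun_scale_def)
      assume g: "g \<in> holo_space U"
      show "f + g \<in> holo_space U"
        using f g holo_on_combination(1)[OF mem[OF f] mem[OF g]] by (simp add: holo_space_def plus_fun_def)
    qed
    fix f g :: "complex^'n \<Rightarrow> complex" and l m :: 'n and a :: complex
    assume f: "f \<in> holo_space U"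
    note hf = mem[OF f]
    show "mult_coord l f \<in> holo_space U"
      using f holo_on_combination(3)[OF hf hf] by (simp add: holo_space_def mult_coord_def)
    show "partial_on U l f \<in> holo_space U" by (rule partial_mem[OF f])
    show "mult_coord l (fun_scale a f) = fun_scale a (mult_coord l f)"
      "mult_coord l (mult_coord m f) = mult_coord m (mult_coord l f)"
      by (auto simp: fun_eq_iff mult_coord_def fun_scale_def)
    show "partial_on U l (fun_scale a f) = fun_scale a (partial_on U l f)"
      using holo_on_combination(5)[OF hf hf]
      by (auto simp: fun_eq_iff partial_on_def restrict_zero_def fun_scale_def)
    show "partial_on U l (partial_on U m f) = partial_on U m (partial_on U l f)"
      using restrict_zero_holo(2)[OF U holo_on_cpartial[OF hf U]] cpartial_commute[OF hf U]
      by (auto simp: fun_eq_iff partial_on_def restrict_zero_def)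
    show "partial_on U l (mult_coord m f) = mult_coord m (partial_on U l f) + (if l = m then f else 0)"
      using holo_on_combination(6)[OF hf hf] f
      by (auto simp: fun_eq_iff partial_on_def restrict_zero_def mult_coord_def holo_space_def)
    assume g: "g \<in> holo_space U"
    show "mult_coord l (f + g) = mult_coord l f + mult_coord l g"
      by (auto simp: fun_eq_iff mult_coord_def algebra_simps)
    show "partial_on U l (f + g) = partial_on U l f + partial_on U l g"
      using holo_on_combination(4)[OF hf mem[OF g]]
      by (auto simp: fun_eq_iff partial_on_def restrict_zero_def plus_fun_def)
  qed
qed

text \<open>Holomorphy is carried along because restriction is exchanged with a partial derivative
  by \<open>restrict_zero_holo\<close>, which applies to holomorphic functions. The
  \<open>foldr\<close> is that of \<open>dmono\<close>, so equations on \<open>U\<close> become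
  equations between elements of \<open>holo_space U\<close>.\<close>

lemma restrict_zero_iterate:
  assumes "open U" "holo_on f U"
  shows "holo_on (foldr (\<lambda>j g. (cpartial j ^^ \<beta> j) g) xs f) U \<and>
     restrict_zero U (foldr (\<lambda>j g. (cpartial j ^^ \<beta> j) g) xs f) =
     foldr (\<lambda>j g. (partial_on U j ^^ \<beta> j) g) xs (restrict_zero U f)"
proof (induction xs)
  case Nil
  then show ?case using assms by simp
next
  case (Cons j xs)
  have "holo_on ((cpartial j ^^ m) g) U \<and>
      restrict_zero U ((cpartial j ^^ m) g) = (partial_on U j ^^ m) (restrict_zero U g)"
    if "holo_on g U" for g m
  proof (induction m)
    case (Suc m)
    then show ?case
      using holo_on_cpartial[OF _ assms(1)] restrict_zero_holo(2)[OF assms(1)]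
      by (metis funpow.simps(2) o_apply)
  qed (use that in simp)
  then show ?case using Cons by simp
qed

section \<open>Monomials and branches of the logarithm\<close>

lemma euler_eigen_monomial:
  fixes h :: "complex^'n::finite \<Rightarrow> complex"
  assumes "convex U" "holo_on h U" "\<And>x j. x \<in> U \<Longrightarrow> x $ j \<noteq> 0"
    and eig: "\<And>x j. x \<in> U \<Longrightarrow> x $ j * cpartial j h x = w $ j * h x"
    and lg: "\<And>x j. x \<in> U \<Longrightarrow> (lg j has_field_derivative inverse (x $ j)) (at (x $ j))"
  shows "\<exists>C. \<forall>x\<in>U. h x = C * exp (\<Sum>j\<in>UNIV. w $ j * lg j (x $ j))"
proof -
  let ?S = "\<lambda>x. \<Sum>j\<in>UNIV. w $ j * lg j (x $ j)"
  \<comment> \<open>Dividing \<open>h\<close> by the candidate monomial leaves a function with zero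
    derivative, which is constant on the convex set \<open>U\<close>.\<close>
  have "((\<lambda>x. h x * exp (- ?S x)) has_derivative (\<lambda>h. 0)) (at x within U)" if x: "x \<in> U" for x
  proof -
    have 1: "((\<lambda>x. lg j (x $ j)) has_derivative (\<lambda>k. inverse (x $ j) * k $ j)) (at x)" for j
      using has_derivative_compose[OF bounded_linear_imp_has_derivative[OF bounded_linear_vec_nth[of j]]
          lg[OF x, of j, unfolded has_field_derivative_def]] by simp
    have dh: "(\<Sum>j\<in>UNIV. k $ j * cpartial j h x) = (\<Sum>j\<in>UNIV. w $ j * (inverse (x $ j) * k $ j)) * h x" for k
      unfolding sum_distrib_right
    proof (rule sum.cong[OF refl])
      fix j
      have "cpartial j h x = w $ j * h x * inverse (x $ j)"
        using eig[OF x, of j] assms(3)[OF x, of j] by (simp add: field_simps)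
      then show "k $ j * cpartial j h x = w $ j * (inverse (x $ j) * k $ j) * h x" by simp
    qed
    let ?dS = "\<lambda>k. \<Sum>j\<in>UNIV. w $ j * (inverse (x $ j) * k $ j)"
    have "((\<lambda>x. - ?S x) has_derivative (\<lambda>k. - ?dS k)) (at x)"
      by (intro has_derivative_minus has_derivative_sum has_derivative_mult_right 1)
    from has_derivative_compose[OF this DERIV_exp[unfolded has_field_derivative_def]]
    have "((\<lambda>x. h x * exp (- ?S x)) has_derivative
       (\<lambda>k. h x * (exp (- ?S x) * - ?dS k) + (\<Sum>j\<in>UNIV. k $ j * cpartial j h x) * exp (- ?S x))) (at x)"
      by (rule has_derivative_mult[OF holo_on_has_derivative[OF assms(2) x]])
    then have "((\<lambda>x. h x * exp (- ?S x)) has_derivative (\<lambda>k. 0)) (at x)"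
      by (simp add: dh)
    then show ?thesis by (rule has_derivative_at_withinI)
  qed
  from has_derivative_zero_constant[OF assms(1) this]
  obtain C where C: "\<And>x. x \<in> U \<Longrightarrow> h x * exp (- ?S x) = C" by blast
  have "h x = C * exp (?S x)" if "x \<in> U" for x
    using C[OF that] by (simp add: exp_minus field_simps)
  then show ?thesis by blast
qed

lemma log_branch_ball:
  fixes z0 :: complex
  assumes "0 \<notin> ball z0 r" "z \<in> ball z0 r"
  defines "lg \<equiv> \<lambda>z. Ln (z / z0) + Ln z0"
  shows "(lg has_field_derivative inverse z) (at z)" "exp (lg z) = z"
proof -
  have "r > 0" using assms(2) by (metis ball_eq_empty empty_iff not_le)
  then have nz: "z0 \<noteq> 0" "z \<noteq> 0" and r: "r \<le> norm z0" using assms by (auto simp: dist_norm)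
  \<comment> \<open>The quotient \<open>z / z0\<close> stays within distance less than 1 of 1, hence
    in the right half-plane, where \<open>Ln\<close> is holomorphic.\<close>
  have "norm (1 - z / z0) = norm (z0 - z) / norm z0"
    using nz by (simp add: diff_divide_distrib flip: norm_divide)
  also have "\<dots> < 1" using assms(2) r nz by (simp add: dist_norm)
  finally have "Re (z / z0) > 0" using complex_Re_le_cmod[of "1 - z / z0"] by simp
  then have "z / z0 \<notin> \<real>\<^sub>\<le>\<^sub>0" by (auto simp: complex_nonpos_Reals_iff)
  then show "(lg has_field_derivative inverse z) (at z)"
    unfolding lg_def using nz
    by (auto intro!: derivative_eq_intros simp: field_simps)
  show "exp (lg z) = z" using nz by (simp add: lg_def exp_add)
qed

section \<open>Generic parameters\<close>

text \<open>The rows of \<open>A\<close> lie in the orthogonal complement of the columns of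
  \<open>B\<close>, which has dimension \<open>CARD('n) - 2\<close>; by their rank they span it. So
  \<open>\<gamma>\<close> is a real combination of these rows, and the equation for \<open>y\<close>
  is linear in the row.\<close>

lemma integer_relation_from_rows:
  fixes B :: "'n::finite \<Rightarrow> 2 \<Rightarrow> int" and A :: "nat \<Rightarrow> 'n \<Rightarrow> int"
    and \<gamma> :: "'n \<Rightarrow> int" and y :: "'n \<Rightarrow> complex"
  assumes B_rank: "int_mat_rank B UNIV = 2"
    and A_rank: "int_mat_rank A {..<CARD('n) - 2} = CARD('n) - 2"
    and AB_zero: "\<forall>k<CARD('n) - 2. \<forall>l. (\<Sum>j\<in>UNIV. A k j * B j l) = 0"
    and \<gamma>: "\<And>l. (\<Sum>j\<in>UNIV. \<gamma> j * B j l) = 0"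
    and y: "\<And>k. k < CARD('n) - 2 \<Longrightarrow> (\<Sum>j\<in>UNIV. of_int (A k j) * y j) = 0"
  shows "(\<Sum>j\<in>UNIV. of_int (\<gamma> j) * y j) = 0"
proof -
  define M :: "real^2^'n" where "M = (\<chi> i l. real_of_int (B i l))"
  define W where "W = {v \<in> UNIV. \<forall>x\<in>span (columns M). orthogonal x v}"
  define vec :: "('n \<Rightarrow> int) \<Rightarrow> real^'n" where "vec a = (\<chi> j. real_of_int (a j))" for a
  define R where "R = (\<lambda>k. vec (A k)) ` {..<CARD('n) - 2}"
  have "rows M = (\<lambda>r. \<chi> c. real_of_int (B r c)) ` UNIV"
    by (auto simp: rows_def row_def M_def)
  then have "dim (rows M) = 2"
    using B_rank by (simp add: int_mat_rank_def)
  then have "dim (columns M) = 2"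
    using row_rank_def[of M] column_rank_def[of M] by simp
  then have "dim W + 2 = CARD('n)"
    using dim_subspace_orthogonal_to_vectors[of "span (columns M)" UNIV]
    by (simp add: W_def)
  then have dimW: "dim W = CARD('n) - 2" by simp
  have mem_W: "vec a \<in> W" if "\<And>l. (\<Sum>j\<in>UNIV. a j * B j l) = 0" for a
  proof -
    have "orthogonal (vec a) x" if "x \<in> span (columns M)" for x
    proof (rule orthogonal_to_span[OF that])
      fix x assume "x \<in> columns M"
      then obtain l where "x = (\<chi> i. real_of_int (B i l))"
        by (auto simp: columns_def column_def M_def)
      then have "vec a \<bullet> x = real_of_int (\<Sum>j\<in>UNIV. a j * B j l)"
        by (simp add: inner_vec_def vec_def)
      also have "\<dots> = 0" by (simp only: \<open>\<And>l. (\<Sum>j\<in>UNIV. a j * B j l) = 0\<close> of_int_0)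
      finally show "orthogonal (vec a) x" by (simp add: orthogonal_def)
    qed
    then show ?thesis by (simp add: W_def orthogonal_commute)
  qed
  have "R \<subseteq> W" using mem_W AB_zero by (auto simp: R_def)
  moreover have "dim R = CARD('n) - 2"
    using A_rank by (simp add: int_mat_rank_def R_def vec_def)
  ultimately have "span R = span W"
    using dimW by (intro dim_eq_span) auto
  moreover have "vec \<gamma> \<in> span W" by (intro span_base mem_W \<gamma>)
  ultimately have "vec \<gamma> \<in> span R" by simp
  then have "(\<Sum>j\<in>UNIV. of_real (vec \<gamma> $ j) * y j) = 0"
  proof (rule span_induct)
    show "subspace {v. (\<Sum>j\<in>UNIV. of_real (v $ j) * y j) = 0}"
      by (auto simp: subspace_def distrib_right sum.distrib mult.assoc simp flip: sum_distrib_left)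
  qed (auto simp: R_def vec_def y)
  then show ?thesis by (simp add: vec_def)
qed

text \<open>The inner product is the real one, so the condition concerns only the real part of
  \<open>\<Sum>l. \<gamma> l * c l\<close>. Each set is a real hyperplane containing the complex one
  that genericity must exclude, and there are countably many.\<close>

lemma negligible_rational_hyperplanes:
  "negligible (\<Union>(\<gamma>, m)\<in>{(\<gamma> :: 'n::finite \<Rightarrow> int, m :: int). \<gamma> \<noteq> (\<lambda>_. 0)}.
      {c :: complex^'n. (\<chi> l. of_int (\<gamma> l)) \<bullet> c = real_of_int m})"
proof (rule negligible_countable_Union)
  fix S assume "S \<in> (\<lambda>(\<gamma>, m). {c :: complex^'n. (\<chi> l. of_int (\<gamma> l)) \<bullet> c = real_of_int m}) `
      {(\<gamma> :: 'n \<Rightarrow> int, m :: int). \<gamma> \<noteq> (\<lambda>_. 0)}"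
  then obtain \<gamma> :: "'n \<Rightarrow> int" and m :: int where
    "\<gamma> \<noteq> (\<lambda>_. 0)" and S: "S = {c. (\<chi> l. of_int (\<gamma> l)) \<bullet> c = real_of_int m}"
    by auto
  then have "(\<chi> l. of_int (\<gamma> l)) \<noteq> (0 :: complex^'n)"
    by (auto simp: vec_eq_iff fun_eq_iff)
  then show "negligible S" unfolding S by (intro negligible_hyperplane) simp
qed simp

lemma sum_fun_apply: "(sum F A) x = (\<Sum>l\<in>A. F l x)"
  by (induction A rule: infinite_finite_induct) auto

theorem theorem8p6:
  fixes B :: "'n::finite \<Rightarrow> 2 \<Rightarrow> int"
    and A :: "nat \<Rightarrow> 'n \<Rightarrow> int"
    and \<alpha> :: "'n \<Rightarrow> nat"
  assumes n_gt: "CARD('n) > 2"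
    and B_rank: "int_mat_rank B UNIV = 2"
    and B_rows_sum: "\<forall>l. (\<Sum>i\<in>UNIV. B i l) = 0"
    and A_rank: "int_mat_rank A {..<CARD('n) - 2} = CARD('n) - 2"
    and A_first_row: "\<forall>j. A 0 j = 1"
    and AB_zero: "\<forall>k<CARD('n) - 2. \<forall>l. (\<Sum>j\<in>UNIV. A k j * B j l) = 0"
    and alpha_supp: "\<forall>i. \<alpha> i > 0 \<longrightarrow> B i 1 > 0"
  shows "\<exists>E :: (complex^'n) set. negligible E \<and>
           (\<forall>c. c \<notin> E \<longrightarrow>
              (\<forall>(x0 :: complex^'n) (r :: real) (f :: complex^'n \<Rightarrow> complex).
                 ball x0 r \<subseteq> {x. \<forall>j. x $ j \<noteq> 0} \<and>
                 is_solution (\<lambda>i. B i 1) (\<lambda>i. B i 2) \<alpha> A (CARD('n) - 2) c f (ball x0 r)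
                 \<longrightarrow> puiseux_on f (ball x0 r)))"
proof (intro exI[of _ "\<Union>(\<gamma>, m)\<in>{(\<gamma> :: 'n \<Rightarrow> int, m :: int). \<gamma> \<noteq> (\<lambda>_. 0)}.
      {c :: complex^'n. (\<chi> l. of_int (\<gamma> l)) \<bullet> c = real_of_int m}"] conjI
    negligible_rational_hyperplanes allI impI, elim conjE)
  fix c x0 :: "complex^'n" and r :: real and f :: "complex^'n \<Rightarrow> complex"
  assume c: "c \<notin> (\<Union>(\<gamma>, m)\<in>{(\<gamma> :: 'n \<Rightarrow> int, m :: int). \<gamma> \<noteq> (\<lambda>_. 0)}.
      {c :: complex^'n. (\<chi> l. of_int (\<gamma> l)) \<bullet> c = real_of_int m})"
    and torus: "ball x0 r \<subseteq> {x. \<forall>j. x $ j \<noteq> 0}"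
    and sol: "is_solution (\<lambda>i. B i 1) (\<lambda>i. B i 2) \<alpha> A (CARD('n) - 2) c f (ball x0 r)"
  define U where "U = ball x0 r"
  define u where "u = (\<lambda>i. B i 1)"
  have U: "open U" "convex U" by (simp_all add: U_def)
  have generic: "\<gamma> = (\<lambda>_. 0)" if "(\<Sum>l\<in>UNIV. of_int (\<gamma> l) * c $ l) = of_int m" for \<gamma> :: "'n \<Rightarrow> int" and m
  proof -
    have "(\<chi> l. of_int (\<gamma> l)) \<bullet> c = Re (\<Sum>l\<in>UNIV. of_int (\<gamma> l) * c $ l)"
      by (simp add: inner_vec_def inner_complex_def)
    also have "\<dots> = real_of_int m" by (simp only: that) simp
    finally show ?thesis using c by auto
  qed
  note sol = sol[unfolded is_solution_def, folded U_def u_def]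
  have holo: "holo_on f U" using sol by blast
  have eq_u: "dmono (pospart u) f x = dmono (negpart u) f x" if "x \<in> U" for x
    using sol that by (metis right_minus_eq)
  have eq_\<alpha>: "dmono \<alpha> f x = 0" if "x \<in> U" for x
    using sol that by blast
  have eq_A: "(\<Sum>j\<in>UNIV. of_int (A k j) * x $ j * cpartial j f x) = (\<Sum>j\<in>UNIV. of_int (A k j) * c $ j) * f x"
    if "x \<in> U" "k < CARD('n) - 2" for x k
  proof -
    have "(\<Sum>j\<in>UNIV. of_int (A k j) * x $ j * cpartial j f x) - (\<Sum>j\<in>UNIV. of_int (A k j) * c $ j) * f x = 0"
      using sol that by blast
    then show ?thesis by (simp only: right_minus_eq)
  qed
  define f0 where "f0 = restrict_zero U f"
  interpret W: weyl_family fun_scale "holo_space U" mult_coord "partial_on U"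
    by (rule holo_space_weyl[OF U(1)])
  define xs :: "'n list" where "xs = (SOME xs. distinct xs \<and> set xs = UNIV)"
  have "\<exists>xs :: 'n list. distinct xs \<and> set xs = UNIV"
    using finite_distinct_list[OF finite_class.finite_UNIV] by blast
  then have "distinct xs \<and> set xs = UNIV" unfolding xs_def by (rule someI_ex)
  then have xs: "distinct xs" "set xs = UNIV" by blast+
  have f0: "f0 \<in> holo_space U" unfolding f0_def by (rule restrict_zero_holo(1)[OF U(1) holo])
  have dpow: "W.dpow xs \<beta> f0 = restrict_zero U (dmono \<beta> f)" for \<beta>
    using restrict_zero_iterate[OF U(1) holo, of \<beta> xs]
    by (simp add: W.dpow_def f0_def dmono_def xs_def)
  have dpow_\<alpha>: "W.dpow xs \<alpha> f0 = 0"
    using eq_\<alpha> by (auto simp: dpow restrict_zero_def fun_eq_iff)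
  \<comment> \<open>\<open>N\<close> bounds every \<open>\<alpha> j\<close>, and
    \<open>pospart u j\<close> is at least 1 wherever \<open>\<alpha> j > 0\<close>; together these
    give \<open>\<alpha> j \<le> N * pospart u j\<close>.\<close>
  define N where "N = sum \<alpha> UNIV"
  have "W.dpow xs (\<lambda>j. N * pospart u j) f0 = 0"
  proof (rule W.dpow_eq_0_mono[OF f0 dpow_\<alpha>])
    fix j
    have "\<alpha> j \<le> N" unfolding N_def by (rule member_le_sum) auto
    moreover have "pospart u j \<ge> 1" if "\<alpha> j > 0"
    proof -
      have "u j > 0" using alpha_supp that unfolding u_def by blast
      then show ?thesis by (simp add: pospart_def)
    qed
    ultimately show "\<alpha> j \<le> N * pospart u j"
      by (metis le0 gr0I mult_le_mono mult_1_right)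
  qed
  moreover have "W.dpow xs (pospart u) f0 = W.dpow xs (negpart u) f0"
    using eq_u by (auto simp: dpow restrict_zero_def fun_eq_iff)
  ultimately have dpow_neg: "W.dpow xs (\<lambda>j. N * negpart u j) f0 = 0"
    using W.dpow_mult_eq[OF f0, of xs "pospart u" "negpart u" N] by simp
  \<comment> \<open>The lines \<open>(i, k)\<close> of \<open>ps\<close> have \<open>u i > 0\<close>
    and those of \<open>qs\<close> have \<open>u i < 0\<close>, so the two families never share an
    index.\<close>
  define ps where "ps = concat (map (\<lambda>j. W.falling j (\<alpha> j)) xs)"
  define qs where "qs = concat (map (\<lambda>j. W.falling j (N * negpart u j)) xs)"
  have factors: "W.factors ps f0 = 0" "W.factors qs f0 = 0"
    unfolding ps_def qs_def
    by (rule W.factors_falling_eq_0[OF xs(1) f0], rule dpow_\<alpha> dpow_neg)+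
  have dist: "distinct ps" "distinct qs"
    unfolding ps_def qs_def by (rule W.distinct_falling; simp add: xs)+
  have ps: "u i > 0 \<and> (\<exists>m. k = of_nat m)" if "(i, k) \<in> set ps" for i k
    using that alpha_supp by (force simp: ps_def W.falling_def u_def)
  have qs: "u i < 0 \<and> (\<exists>m. k = of_nat m)" if "(i, k) \<in> set qs" for i k
  proof -
    have "\<exists>m<N * negpart u i. k = of_nat m"
      using that by (auto simp: qs_def W.falling_def)
    then obtain m where m: "m < N * negpart u i" "k = of_nat m" by blast
    then have "negpart u i \<noteq> 0" by (metis mult_0_right not_less_zero)
    then show ?thesis using m(2) by (auto simp: negpart_def)
  qed
  \<comment> \<open>The system supplies relations for the rows of \<open>A\<close> only, whereas
    transversality uses every integer vector orthogonal to both columns of \<open>B\<close>;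
    \<open>integer_relation_from_rows\<close> bridges the two when \<open>f0\<close> is placed in
    \<open>V\<close>.\<close>
  define \<Gamma> where "\<Gamma> = {\<lambda>l. of_int (\<gamma> l) :: complex | \<gamma>. \<forall>l. (\<Sum>j\<in>UNIV. \<gamma> j * B j l) = 0}"
  define V where "V = {h \<in> holo_space U. \<forall>\<gamma>\<in>\<Gamma>.
      (\<Sum>l\<in>UNIV. fun_scale (\<gamma> l) (W.euler l h - fun_scale (c $ l) h)) = 0}"
  interpret S: commuting_family fun_scale V W.euler
    unfolding V_def by (rule W.commuting_family_relations)
  have "f0 \<in> V"
    unfolding V_def
  proof (intro CollectI conjI f0 ballI)
    fix \<gamma>' assume "\<gamma>' \<in> \<Gamma>"
    then obtain \<gamma> where \<gamma>: "\<gamma>' = (\<lambda>l. of_int (\<gamma> l))" "\<And>l. (\<Sum>j\<in>UNIV. \<gamma> j * B j l) = 0"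
      by (auto simp: \<Gamma>_def)
    show "(\<Sum>l\<in>UNIV. fun_scale (\<gamma>' l) (W.euler l f0 - fun_scale (c $ l) f0)) = 0"
    proof
      fix x
      have "(\<Sum>l\<in>UNIV. of_int (\<gamma> l) * (x $ l * cpartial l f x - c $ l * f x)) = 0" if "x \<in> U"
      proof (rule integer_relation_from_rows[OF B_rank A_rank AB_zero \<gamma>(2)])
        fix k assume "k < CARD('n) - 2"
        from eq_A[OF that this]
        show "(\<Sum>j\<in>UNIV. of_int (A k j) * (x $ j * cpartial j f x - c $ j * f x)) = 0"
          by (simp add: right_diff_distrib sum_subtractf sum_distrib_right mult.assoc)
      qed
      then show "(\<Sum>l\<in>UNIV. fun_scale (\<gamma>' l) (W.euler l f0 - fun_scale (c $ l) f0)) x = 0 x"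
        using restrict_zero_holo(2)[OF U(1) holo]
        by (simp add: sum_fun_apply fun_scale_def W.euler_def f0_def mult_coord_def restrict_zero_def \<gamma>(1))
    qed
  qed
  have "S.generic_lines ps qs"
  proof (rule S.generic_linesI)
    show "distinct (ps @ qs)" using dist ps qs by fastforce
    fix i k j k' h
    assume 2: "(i, k) \<in> set ps" "(j, k') \<in> set qs" "h \<in> V"
      "W.euler i h = fun_scale k h" "W.euler j h = fun_scale k' h"
    obtain m m' where m: "k = of_nat m" "k' = of_nat m'"
      using ps qs 2 by blast
    have "\<exists>w. S.joint_eigen w h \<and> w i = of_nat m \<and> w j = of_nat m' \<and>
             (\<forall>l. l \<noteq> i \<longrightarrow> l \<noteq> j \<longrightarrow> w l \<notin> \<nat>)"
    proof (rule S.transversal_intersection[where p = u and q = "\<lambda>i. B i 2" and c = "\<lambda>l. c $ l"])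
      fix h and \<gamma> :: "'n \<Rightarrow> int"
      assume h: "h \<in> V" and \<gamma>: "(\<Sum>l\<in>UNIV. \<gamma> l * u l) = 0" "(\<Sum>l\<in>UNIV. \<gamma> l * B l 2) = 0"
      have "\<forall>l. (\<Sum>j\<in>UNIV. \<gamma> j * B j l) = 0"
        using \<gamma> by (simp add: forall_2 u_def)
      then have "(\<lambda>l. of_int (\<gamma> l)) \<in> \<Gamma>" by (auto simp: \<Gamma>_def)
      then show "(\<Sum>l\<in>UNIV. fun_scale (of_int (\<gamma> l)) (W.euler l h - fun_scale (c $ l) h)) = 0"
        using h by (force simp: V_def)
    next
      show "i \<noteq> j" "u i \<noteq> 0" using ps[of i k] qs[of j k'] 2 by auto
    qed (use 2 m generic in auto)
    then obtain w where w: "S.joint_eigen w h" "w i = k" "w j = k'"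
      "\<And>l. l \<noteq> i \<Longrightarrow> l \<noteq> j \<Longrightarrow> w l \<notin> \<nat>"
      using m by blast
    \<comment> \<open>A different line with index \<open>i\<close> or \<open>j\<close> prescribes a
      different value for the same operator; any other index has a non-natural weight, while all
      lines carry natural numbers.\<close>
    have "w l \<noteq> m" if lm: "(l, m) \<in> set ps \<union> set qs - {(i, k), (j, k')}" for l m
    proof (cases "l = i \<or> l = j")
      case True
      then show ?thesis using lm w(2,3) by auto
    next
      case False
      moreover have "m \<in> \<nat>" using lm ps[of l m] qs[of l m] by auto
      ultimately show ?thesis using w(4)[of l] by auto
    qed
    then show "\<exists>w. S.joint_eigen w h \<and> w i = k \<and> w j = k' \<and>
        (\<forall>(l, m)\<in>set ps \<union> set qs - {(i, k), (j, k')}. w l \<noteq> m)"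
      using w(1-3) by (intro exI[of _ w]) blast
  qed
  from S.joint_eigen_decomposition[OF this \<open>f0 \<in> V\<close> factors]
  have f0_span: "f0 \<in> W.span {h. \<exists>w. S.joint_eigen w h}" .
  have coord: "x $ j \<in> ball (x0 $ j) r" if "x \<in> U" for x j
    using that Finite_Cartesian_Product.norm_nth_le[of "x0 - x" j] by (simp add: U_def dist_norm)
  have zero_notin: "0 \<notin> ball (x0 $ j) r" for j
  proof
    assume "0 \<in> ball (x0 $ j) r"
    \<comment> \<open>This point is the centre with its \<open>j\<close>-th coordinate replaced by
      0, which the torus condition forbids.\<close>
    then have "x0 + axis j (- x0 $ j) \<in> ball x0 r"
      by (simp add: dist_norm norm_axis)
    then have "(x0 + axis j (- x0 $ j)) $ j \<noteq> 0" using torus by blast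
    then show False by (simp add: axis_def)
  qed
  define lg where "lg j z = Ln (z / x0 $ j) + Ln (x0 $ j)" for j z
  have lg: "(lg j has_field_derivative inverse z) (at z)" "exp (lg j z) = z"
    if "z \<in> ball (x0 $ j) r" for j z
    using log_branch_ball[OF zero_notin that] unfolding lg_def by blast+
  have "\<exists>P coef. finite P \<and> (\<forall>x\<in>U. h x = (\<Sum>p\<in>P. coef p * exp (\<Sum>j\<in>UNIV. p $ j * lg j (x $ j))))"
    if "h \<in> W.span {h. \<exists>w. S.joint_eigen w h}" for h
    using that
  proof (induction rule: W.span_induct_alt)
    case base
    show ?case by (intro exI[of _ "{}"]) simp
  next
    case (step a g h)
    let ?E = "\<lambda>p x. exp (\<Sum>j\<in>UNIV. p $ j * lg j (x $ j))"
    from step obtain P coef where P: "finite P" "\<And>x. x \<in> U \<Longrightarrow> h x = (\<Sum>p\<in>P. coef p * ?E p x)"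
      by blast
    from step obtain w' where w': "S.joint_eigen w' g" by blast
    define w :: "complex^'n" where "w = (\<chi> j. w' j)"
    have "\<exists>C. \<forall>x\<in>U. g x = C * ?E w x"
    proof (rule euler_eigen_monomial[OF U(2)])
      have "g \<in> V" using w' by (simp add: S.joint_eigen_def)
      then show "holo_on g U" by (simp add: V_def holo_space_def)
      show "x $ j * cpartial j g x = w $ j * g x" if "x \<in> U" for x j
      proof -
        have "W.euler j g = fun_scale (w' j) g" using w' by (simp add: S.joint_eigen_def)
        from fun_cong[OF this, of x] show ?thesis
          using that by (simp add: W.euler_def mult_coord_def partial_on_def restrict_zero_def fun_scale_def w_def)
      qed
    qed (use torus coord lg in \<open>auto simp: U_def\<close>)
    then obtain C where C: "\<And>x. x \<in> U \<Longrightarrow> g x = C * ?E w x" by blast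
    \<comment> \<open>The exponent \<open>w\<close> may already belong to \<open>P\<close>, in which
      case the two coefficients add up.\<close>
    define coef' where "coef' p = (if p \<in> P then coef p else 0) + (if p = w then a * C else 0)" for p
    have "(fun_scale a g + h) x = (\<Sum>p\<in>insert w P. coef' p * ?E p x)" if x: "x \<in> U" for x
    proof -
      have "(\<Sum>p\<in>insert w P. (if p \<in> P then coef p else 0) * ?E p x) = (\<Sum>p\<in>P. coef p * ?E p x)"
        using P(1) by (intro sum.mono_neutral_cong_right) auto
      moreover have "(\<Sum>p\<in>insert w P. (if p = w then a * C else 0) * ?E p x) = a * C * ?E w x"
        using P(1) by (simp add: if_distrib[of "\<lambda>z. z * _"] cong: if_cong)
      ultimately show ?thesis
        by (simp add: coef'_def distrib_right sum.distrib fun_scale_def P(2)[OF x] C[OF x] del: sum.insert)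
    qed
    then show ?case using P(1) by (intro exI[of _ "insert w P"] exI[of _ coef']) auto
  qed
  from this[OF f0_span] obtain P coef where
    P: "finite P" "\<And>x. x \<in> U \<Longrightarrow> f0 x = (\<Sum>p\<in>P. coef p * exp (\<Sum>j\<in>UNIV. p $ j * lg j (x $ j)))"
    by blast
  have "continuous_on ((\<lambda>x. x $ j) ` U) (lg j)" for j
    by (rule continuous_at_imp_continuous_on) (use lg(1) coord DERIV_isCont in blast)
  moreover have "f x = (\<Sum>p\<in>P. coef p * exp (\<Sum>j\<in>UNIV. p $ j * lg j (x $ j)))" if "x \<in> U" for x
    using P(2)[OF that] that by (simp add: f0_def restrict_zero_def)
  ultimately show "puiseux_on f (ball x0 r)"
    unfolding puiseux_on_def U_def[symmetric] using P(1) lg(2) coord by blast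
qed

end
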